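(* Let $n\geq 1$ be an integer. Assume that $\psi\colon\mathbb{N}\to(0,\infty)$ is non-increasing and satisfies $\psi(s)=o(s^{-\frac{n+1}{n}})$ as $s\to\infty$. Then the set $E(\psi)$ of exact $\psi$-approximable vectors in $\mathbb{R}^n$ satisfies $$\dim_H E(\psi)=\dim_H W(\psi).$$
   Context: $\dim_H$ denotes Hausdorff dimension. $\mathbb{R}^n$ carries the norm $\|x\|=\max_{1\leq i\leq n}|x_i|$. For a non-increasing $\psi\colon\mathbb{N}\to(0,\infty)$, the set of $\psi$-approximable points is $$W(\psi)=\Big\{x\in\mathbb{R}^n : \text{there exist infinitely many rational points } \tfrac{p}{q}\in\mathbb{Q}^n \text{ with } \big\|x-\tfrac{p}{q}\big\|<\psi(q)\Big\},$$ where $p\in\mathbb{Z}^n$ and $q\geq 1$ is an integer. The set of exact $\psi$-approximable vectors is $$E(\psi)=W(\psi)\setminus\bigcup_{0<c<1}W(c\psi).$$ *)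

theory Defs
  imports "HOL-Analysis.Analysis" "HOL-Library.Landau_Symbols"
begin

(* Hausdorff measures are taken with respect to an explicit distance function d, because
   real ^ 'n carries the Euclidean metric as its type class instance, while the ambient
   metric here is the one of the maximum norm. The library's diameter is real-valued and
   unspecified on unbounded sets, hence the ennreal-valued version. *)

definition ediam :: "('a \<Rightarrow> 'a \<Rightarrow> real) \<Rightarrow> 'a set \<Rightarrow> ennreal" where
  "ediam d U = (SUP x\<in>U. SUP y\<in>U. ennreal (d x y))"

(* (diam U)^s with the conventions (diam {})^0 = 0 and (diam U)^0 = 1 for nonempty U
   (powr has 0 powr 0 = 0), so that the measure for s = 0 is counting measure.
   Only used for sets of finite diameter. *)
definition diam_pow :: "('a \<Rightarrow> 'a \<Rightarrow> real) \<Rightarrow> real \<Rightarrow> 'a set \<Rightarrow> ennreal" where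
  "diam_pow d s U =
     (if U = {} then 0 else if s = 0 then 1 else ennreal (enn2real (ediam d U) powr s))"

definition hausdorff_premeasure ::
    "('a \<Rightarrow> 'a \<Rightarrow> real) \<Rightarrow> real \<Rightarrow> real \<Rightarrow> 'a set \<Rightarrow> ennreal" where
  "hausdorff_premeasure d s \<delta> A =
     (INF U\<in>{U :: nat \<Rightarrow> 'a set. A \<subseteq> (\<Union>i. U i) \<and> (\<forall>i. ediam d (U i) \<le> ennreal \<delta>)}.
        \<Sum>i. diam_pow d s (U i))"

definition hausdorff_measure ::
    "('a \<Rightarrow> 'a \<Rightarrow> real) \<Rightarrow> real \<Rightarrow> 'a set \<Rightarrow> ennreal" where
  "hausdorff_measure d s A = (SUP \<delta>\<in>{0<..}. hausdorff_premeasure d s \<delta> A)"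

definition hausdorff_dim :: "('a \<Rightarrow> 'a \<Rightarrow> real) \<Rightarrow> 'a set \<Rightarrow> ennreal" where
  "hausdorff_dim d A = (INF s\<in>{s. 0 \<le> s \<and> hausdorff_measure d s A = 0}. ennreal s)"

(* infnorm is the maximum norm on real ^ 'n. *)
definition max_dist :: "real ^ 'n \<Rightarrow> real ^ 'n \<Rightarrow> real" where
  "max_dist x y = infnorm (x - y)"

definition rational_point :: "int ^ 'n \<Rightarrow> nat \<Rightarrow> real ^ 'n" where
  "rational_point p q = (\<chi> i. real_of_int (p $ i) / real q)"

(* Infinitely many points, not infinitely many representations (p, q): a rational x is
   not counted as approximated by itself through the representations (k p, k q). *)
definition W :: "(nat \<Rightarrow> real) \<Rightarrow> (real ^ 'n) set" where
  "W \<psi> = {x. infinite {r. \<exists>p q. 1 \<le> q \<and> r = rational_point p q \<and> max_dist x r < \<psi> q}}"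

definition E :: "(nat \<Rightarrow> real) \<Rightarrow> (real ^ 'n) set" where
  "E \<psi> = W \<psi> - (\<Union>c\<in>{0<..<1}. W (\<lambda>q. c * \<psi> q))"

end

theory Submission
  imports Defs
begin

text \<open>
Write n for the dimension and \<alpha> = (n + 1) / n. A direct cover shows that H^s (W \<psi>) = 0 as soon as
s > s1 and \<psi> q \<le> q powr (- (n + 1) / s1) for all large q; otherwise \<psi> Q \<ge> Q powr (- \<tau>), \<tau> = (n + 1) / s1,
for infinitely many Q, and then H^t (E \<psi>) > 0 for all t < s1 follows by a Cantor construction.

Inside a cube of radius r the rational points of denominator at most a constant times r powr (- 1 / \<alpha>) lie on
a hyperplane, by a determinant estimate, and this hyperplane misses one of the orthants at the centre. Subdividing
that orthant only gives G ^ n separated cubes of radius r / (4 G) whose points x satisfy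
|x - p/q| \<ge> \<kappa> q powr (- \<alpha>) for ever larger q; in exponent this is an arbitrarily small loss for large G.
Once r is about Q powr (- \<alpha>) for a prescribed Q, each cube contains a rational p/q with q comparable to Q and
with no rational of smaller denominator nearby. All rationals of denominator up to a large multiple of
\<psi> q powr (- 1 / \<alpha>) close to p/q lie on one hyperplane through p/q, because \<psi> q = o(q powr (- \<alpha>)). In the maximum
norm there is a corner direction in which the distance to p/q and the distance to that hyperplane agree, so a cube of
radius about \<epsilon> \<psi> q at distance slightly less than \<psi> q from p/q in this direction keeps the distance
(1 - \<epsilon>) \<psi> q' from all other p'/q', and the subdivision is resumed there. Letting \<epsilon> tend to 0, all limit
points are in E \<psi>. Reading off base G ^ n digits maps the limit set onto [0, 1) by a Hoelder continuous map, which
bounds its Hausdorff measure from below.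
\<close>

section \<open>The maximum norm and Hausdorff measure\<close>

lemma infnorm_le_iff:
  fixes x :: "real ^ 'n"
  shows "infnorm x \<le> d \<longleftrightarrow> (\<forall>i. \<bar>x $ i\<bar> \<le> d)"
proof -
  have "{\<bar>x $ i\<bar> |i. i \<in> UNIV} = range (\<lambda>i. \<bar>x $ i\<bar>)" by auto
  then have "infnorm x = Max (range (\<lambda>i. \<bar>x $ i\<bar>))"
    unfolding infnorm_cart by (simp add: cSup_eq_Max)
  then show ?thesis by simp
qed

lemma max_dist_le_iff: "max_dist x y \<le> d \<longleftrightarrow> (\<forall>i. \<bar>x $ i - y $ i\<bar> \<le> d)"
  by (simp add: max_dist_def infnorm_le_iff)

lemma abs_component_le_max_dist: "\<bar>x $ i - y $ i\<bar> \<le> max_dist x y"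
  using max_dist_le_iff by blast

lemma max_dist_nonneg [simp]: "0 \<le> max_dist x y"
  by (simp add: max_dist_def infnorm_pos_le)

lemma max_dist_self [simp]: "max_dist x x = 0"
  by (simp add: max_dist_def infnorm_0)

lemma max_dist_sym: "max_dist x y = max_dist y x"
  by (simp add: max_dist_def infnorm_sub)

lemma max_dist_triangle: "max_dist x z \<le> max_dist x y + max_dist y z"
  unfolding max_dist_def using infnorm_triangle[of "x - y" "y - z"] by simp

lemma finite_int_box:
  fixes M :: int
  shows "finite {p :: int ^ 'n. \<forall>i. \<bar>p $ i\<bar> \<le> M}"
    and "0 \<le> M \<Longrightarrow> card {p :: int ^ 'n. \<forall>i. \<bar>p $ i\<bar> \<le> M} \<le> nat (2 * M + 1) ^ CARD('n)"
proof -
  let ?F = "Pi\<^sub>E (UNIV :: 'n set) (\<lambda>_. {-M..M})"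
  have sub: "{p :: int ^ 'n. \<forall>i. \<bar>p $ i\<bar> \<le> M} \<subseteq> vec_lambda ` ?F"
  proof
    fix p :: "int ^ 'n" assume p: "p \<in> {p. \<forall>i. \<bar>p $ i\<bar> \<le> M}"
    have "vec_nth p \<in> ?F" using p by (auto simp: abs_le_iff) (metis minus_le_iff)
    then show "p \<in> vec_lambda ` ?F" by (metis imageI vec_nth_inverse)
  qed
  have fin: "finite ?F" by (simp add: finite_PiE)
  show "finite {p :: int ^ 'n. \<forall>i. \<bar>p $ i\<bar> \<le> M}"
    using finite_subset[OF sub] fin by blast
  assume "0 \<le> M"
  have "card {p :: int ^ 'n. \<forall>i. \<bar>p $ i\<bar> \<le> M} \<le> card ?F"
    using card_mono[OF _ sub] card_image_le[OF fin, of vec_lambda] fin by fastforce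
  also have "card ?F = nat (2 * M + 1) ^ CARD('n)" 
    using \<open>0 \<le> M\<close> by (simp add: card_PiE algebra_simps)
  finally show "card {p :: int ^ 'n. \<forall>i. \<bar>p $ i\<bar> \<le> M} \<le> nat (2 * M + 1) ^ CARD('n)" .
qed

section \<open>Diameters, Hausdorff null sets and a lower bound for Hausdorff measure\<close>

lemma ediam_ge: "x \<in> U \<Longrightarrow> y \<in> U \<Longrightarrow> ennreal (d x y) \<le> ediam d U"
  unfolding ediam_def by (meson SUP_upper2 order_refl)

lemma ediam_le:
  "(\<And>x y. x \<in> U \<Longrightarrow> y \<in> U \<Longrightarrow> d x y \<le> r) \<Longrightarrow> ediam d U \<le> ennreal r"
  unfolding ediam_def by (intro SUP_least ennreal_leI) auto

lemma diam_pow_empty [simp]: "diam_pow d s {} = 0"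
  by (simp add: diam_pow_def)

lemma diam_pow_le:
  assumes "\<And>x y. x \<in> U \<Longrightarrow> y \<in> U \<Longrightarrow> d x y \<le> r" "0 \<le> r" "0 < s"
  shows "diam_pow d s U \<le> ennreal (r powr s)"
proof -
  have "ediam d U \<le> ennreal r" using assms by (intro ediam_le) auto
  then have "enn2real (ediam d U) \<le> r" using assms by (simp add: enn2real_leI)
  then show ?thesis
    using assms unfolding diam_pow_def by (auto intro!: ennreal_leI powr_mono2)
qed

lemma hausdorff_measure_eq_0I:
  assumes "\<And>\<delta>. 0 < \<delta> \<Longrightarrow> hausdorff_premeasure d s \<delta> A = 0"
  shows "hausdorff_measure d s A = 0"
  unfolding hausdorff_measure_def using assms by (intro antisym SUP_least) auto

lemma hausdorff_premeasure_mono: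
  "A \<subseteq> B \<Longrightarrow> hausdorff_premeasure d s \<delta> A \<le> hausdorff_premeasure d s \<delta> B"
  unfolding hausdorff_premeasure_def by (intro INF_superset_mono) auto

lemma hausdorff_measure_mono: "A \<subseteq> B \<Longrightarrow> hausdorff_measure d s A \<le> hausdorff_measure d s B"
  unfolding hausdorff_measure_def by (intro SUP_mono) (metis hausdorff_premeasure_mono)

lemma hausdorff_dim_mono: "A \<subseteq> B \<Longrightarrow> hausdorff_dim d A \<le> hausdorff_dim d B"
  unfolding hausdorff_dim_def
  using hausdorff_measure_mono[of A B d]
  by (intro INF_superset_mono) (auto simp: le_zero_eq[symmetric] simp del: le_zero_eq intro: order_trans)

lemma hausdorff_premeasure_le_double_cover:
  fixes U :: "nat \<Rightarrow> nat \<Rightarrow> 'a set"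
  assumes "A \<subseteq> (\<Union>i. \<Union>j. U i j)" "\<And>i j. ediam d (U i j) \<le> ennreal \<delta>"
  shows "hausdorff_premeasure d s \<delta> A \<le> (\<Sum>i. \<Sum>j. diam_pow d s (U i j))"
proof -
  define V where "V = (\<lambda>k. case prod_decode k of (i, j) \<Rightarrow> U i j)"
  have "A \<subseteq> (\<Union>k. V k)"
  proof
    fix x assume "x \<in> A"
    then obtain i j where "x \<in> U i j" using assms(1) by auto
    then have "x \<in> V (prod_encode (i, j))" by (simp add: V_def)
    then show "x \<in> (\<Union>k. V k)" by blast
  qed
  moreover have "\<forall>k. ediam d (V k) \<le> ennreal \<delta>"
    using assms(2) by (auto simp: V_def split: prod.split)
  ultimately have "hausdorff_premeasure d s \<delta> A \<le> (\<Sum>k. diam_pow d s (V k))"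
    unfolding hausdorff_premeasure_def by (intro INF_lower) auto
  also have "\<dots> = (\<Sum>k. (\<lambda>(i, j). diam_pow d s (U i j)) (prod_decode k))"
    by (simp add: V_def split_beta)
  also have "\<dots> = (\<Sum>i. \<Sum>j. diam_pow d s (U i j))"
    by (rule suminf_ennreal_2dimen) auto
  finally show ?thesis .
qed

text \<open>Measure 0 makes every premeasure 0, so the \<open>i\<close>-th set has covers of weight
  below \<open>e * (1 / 2) ^ Suc i\<close>; together they cover the union with weight at most
  \<open>e\<close>.\<close>

lemma hausdorff_measure_Union_null:
  fixes A :: "nat \<Rightarrow> 'a set"
  assumes "\<And>i. hausdorff_measure d s (A i) = 0"
  shows "hausdorff_measure d s (\<Union>i. A i) = 0"
proof (rule hausdorff_measure_eq_0I)
  fix \<delta> :: real assume \<delta>: "0 < \<delta>"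
  have pre: "hausdorff_premeasure d s \<delta> (A i) = 0" for i
  proof -
    have "hausdorff_premeasure d s \<delta> (A i) \<le> hausdorff_measure d s (A i)"
      unfolding hausdorff_measure_def using \<delta> by (intro SUP_upper) auto
    then show ?thesis using assms[of i] by simp
  qed
  show "hausdorff_premeasure d s \<delta> (\<Union>i. A i) = 0"
  proof (rule antisym)
    show "hausdorff_premeasure d s \<delta> (\<Union>i. A i) \<le> 0"
    proof (rule ennreal_le_epsilon)
      fix e :: real assume e: "0 < e"
      have "\<exists>U. A i \<subseteq> (\<Union>j. U j) \<and> (\<forall>j. ediam d (U j) \<le> ennreal \<delta>) \<and>
              (\<Sum>j. diam_pow d s (U j)) < ennreal (e * (1 / 2) ^ Suc i)" for i
      proof -
        have "hausdorff_premeasure d s \<delta> (A i) < ennreal (e * (1 / 2) ^ Suc i)"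
          unfolding pre using e by (simp add: ennreal_zero_less_mult_iff)
        then show ?thesis unfolding hausdorff_premeasure_def INF_less_iff by auto
      qed
      then obtain U where U: "\<And>i. A i \<subseteq> (\<Union>j. U i j)" "\<And>i j. ediam d (U i j) \<le> ennreal \<delta>"
        "\<And>i. (\<Sum>j. diam_pow d s (U i j)) < ennreal (e * (1 / 2) ^ Suc i)" by metis
      have "hausdorff_premeasure d s \<delta> (\<Union>i. A i) \<le> (\<Sum>i. \<Sum>j. diam_pow d s (U i j))"
        using U(1,2) by (intro hausdorff_premeasure_le_double_cover) fastforce+
      also have "\<dots> \<le> (\<Sum>i. ennreal (e * (1 / 2) ^ Suc i))"
        using U(3) by (intro suminf_le) (auto intro: less_imp_le)
      also have "\<dots> = ennreal e"
      proof (rule suminf_ennreal_eq)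
        show "(\<lambda>i. e * (1 / 2) ^ Suc i) sums e"
          using sums_mult[OF power_half_series, of e] by simp
      qed (use e in auto)
      finally show "hausdorff_premeasure d s \<delta> (\<Union>i. A i) \<le> 0 + ennreal e" by simp
    qed
  qed auto
qed

text \<open>The inverse of \<open>g\<close> is Hoelder, so a cover of \<open>A\<close> pulls back to
  a cover of [0, 1) by sets whose lengths are controlled by the diameters; Lebesgue measure then
  bounds the sum of the powers from below.\<close>

lemma hausdorff_measure_neq_0_of_inverse_Holder:
  fixes g :: "real \<Rightarrow> 'a"
  assumes gA: "\<And>t. t \<in> {0..<1} \<Longrightarrow> g t \<in> A"
    and holder: "\<And>t u. t \<in> {0..<1} \<Longrightarrow> u \<in> {0..<1} \<Longrightarrow> \<bar>t - u\<bar> \<le> C * d (g t) (g u) powr r"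
    and C: "0 < C" and r: "0 < r" and s: "0 \<le> s" "s \<le> r"
    and nonneg: "\<And>x y. 0 \<le> d x y"
  shows "hausdorff_measure d s A \<noteq> 0"
proof -
  \<comment> \<open>One scale is enough, the measure being a supremum over scales. Scale 1 makes the
    \<open>r\<close>-th power of a diameter at most its \<open>s\<close>-th power, as
    \<open>s \<le> r\<close>.\<close>
  have "ennreal (1 / (2 * C)) \<le> hausdorff_premeasure d s 1 A"
    unfolding hausdorff_premeasure_def
  proof (rule INF_greatest, clarify)
    fix U :: "nat \<Rightarrow> 'a set"
    assume cover: "A \<subseteq> (\<Union>i. U i)" and diam: "\<forall>i. ediam d (U i) \<le> ennreal 1"
    define V where "V = (\<lambda>i. {t \<in> {0..<1}. g t \<in> U i})"
    define t0 where "t0 = (\<lambda>i. SOME t. t \<in> V i)"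
    define L where "L = (\<lambda>i. if V i = {} then 0 else C * enn2real (ediam d (U i)) powr r)"
    \<comment> \<open>The preimage \<open>V i\<close> need not be measurable; it is enclosed in an
      interval of half-length \<open>L i\<close> around one of its points, which costs the factor 2
      in the constant.\<close>
    define I where "I = (\<lambda>i. if V i = {} then {} else {t0 i - L i..t0 i + L i})"
    have L0: "0 \<le> L i" for i using C by (simp add: L_def)
    have V_le: "\<bar>t - u\<bar> \<le> L i" if "t \<in> V i" "u \<in> V i" for t u i
    proof -
      have "ennreal (d (g t) (g u)) \<le> ediam d (U i)" using that by (auto simp: V_def intro: ediam_ge)
      then have "d (g t) (g u) \<le> enn2real (ediam d (U i))"
        using diam[rule_format, of i] nonneg
        by (metis enn2real_ennreal enn2real_mono ennreal_less_top le_less_trans)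
      then have "d (g t) (g u) powr r \<le> enn2real (ediam d (U i)) powr r"
        using nonneg r by (intro powr_mono2) auto
      then have "C * d (g t) (g u) powr r \<le> C * enn2real (ediam d (U i)) powr r"
        using C by simp
      then show ?thesis using holder[of t u] that by (auto simp: V_def L_def)
    qed
    have VI: "V i \<subseteq> I i" for i
    proof
      fix t assume t: "t \<in> V i"
      then have "t0 i \<in> V i" unfolding t0_def by (metis someI)
      with V_le[OF t this] t show "t \<in> I i" by (auto simp: I_def abs_le_iff)
    qed
    have mI: "emeasure lborel (I i) = ennreal (2 * L i)" for i
    proof (cases "V i = {}")
      case True then show ?thesis by (simp add: I_def L_def)
    next
      case False
      have "t0 i - L i \<le> t0 i + L i" using L0[of i] by simp
      from emeasure_lborel_Icc[OF this] False show ?thesis by (simp add: I_def)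
    qed
    have sI: "range I \<subseteq> sets lborel" by (auto simp: I_def)
    have LU: "ennreal (2 * L i) \<le> ennreal (2 * C) * diam_pow d s (U i)" for i
    proof (cases "V i = {}")
      case True then show ?thesis by (simp add: L_def)
    next
      case False
      then have ne: "U i \<noteq> {}" by (auto simp: V_def)
      let ?D = "enn2real (ediam d (U i))"
      have D: "0 \<le> ?D" "?D \<le> 1" using diam by (auto intro: enn2real_leI)
      have le: "ennreal (?D powr r) \<le> diam_pow d s (U i)"
      proof (cases "s = 0")
        case True
        have "?D powr r \<le> 1" using D r by (simp add: powr_le1)
        then show ?thesis using True ne by (simp add: diam_pow_def)
      next
        case False
        have "?D powr r \<le> ?D powr s"
          using D s by (cases "?D = 0") (auto intro: powr_mono')
        then show ?thesis using False ne by (simp add: diam_pow_def ennreal_leI)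
      qed
      have "ennreal (2 * L i) = ennreal (2 * C) * ennreal (?D powr r)"
        using False C by (simp add: L_def ennreal_mult[symmetric] mult.assoc)
      then show ?thesis using le by (simp add: mult_left_mono)
    qed
    have "{0..<1::real} \<subseteq> (\<Union>i. I i)"
    proof
      fix t :: real assume t: "t \<in> {0..<1}"
      then obtain i where "g t \<in> U i" using gA cover by blast
      then show "t \<in> (\<Union>i. I i)" using VI[of i] t by (auto simp: V_def)
    qed
    then have "emeasure lborel {0..<1::real} \<le> emeasure lborel (\<Union>i. I i)"
      using sI by (intro emeasure_mono) auto
    also have "\<dots> \<le> (\<Sum>i. emeasure lborel (I i))"
      using sI by (rule emeasure_subadditive_countably)
    also have "\<dots> \<le> (\<Sum>i. ennreal (2 * C) * diam_pow d s (U i))"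
      unfolding mI using LU by (intro suminf_le) auto
    also have "\<dots> = ennreal (2 * C) * (\<Sum>i. diam_pow d s (U i))" by simp
    finally have "1 \<le> ennreal (2 * C) * (\<Sum>i. diam_pow d s (U i))" by simp
    then have "ennreal (1 / (2 * C)) * 1
        \<le> ennreal (1 / (2 * C)) * (ennreal (2 * C) * (\<Sum>i. diam_pow d s (U i)))"
      by (rule mult_left_mono) simp
    also have "\<dots> = (\<Sum>i. diam_pow d s (U i))"
      using C by (simp add: mult.assoc[symmetric] ennreal_mult[symmetric])
    finally show "ennreal (1 / (2 * C)) \<le> (\<Sum>i. diam_pow d s (U i))" by simp
  qed
  also have "\<dots> \<le> hausdorff_measure d s A"
    unfolding hausdorff_measure_def by (intro SUP_upper) auto
  finally show ?thesis using C by auto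
qed

section \<open>Rational points near a point lie on a hyperplane\<close>

text \<open>Iterates the single row operation over \<open>T\<close>; as \<open>i0\<close> is outside
  \<open>T\<close>, the row that is added never changes along the induction.\<close>

lemma det_add_multiples_of_row:
  fixes A :: "real ^ 'm::finite ^ 'm"
  assumes "finite T" "i0 \<notin> T"
  shows "det (\<chi> k. if k \<in> T then row k A + c k *s row i0 A else row k A) = det A"
  using assms
proof (induction T)
  case empty
  have "(\<chi> k. row k A) = A" by (simp add: vec_eq_iff row_def)
  then show ?case by simp
next
  case (insert j T)
  let ?B = "(\<chi> k. if k \<in> T then row k A + c k *s row i0 A else row k A)"
  have "j \<noteq> i0" using insert by auto
  have r: "row j ?B = row j A" "row i0 ?B = row i0 A"
    using insert by (auto simp: row_def vec_eq_iff)
  have "(\<chi> k. if k = j then row j ?B + c j *s row i0 ?B else row k ?B)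
      = (\<chi> k. if k \<in> insert j T then row k A + c k *s row i0 A else row k A)"
    unfolding r using insert by (auto simp: row_def vec_eq_iff)
  with det_row_operation[OF \<open>j \<noteq> i0\<close>, of ?B "c j"] insert show ?case by simp
qed

lemma prod_UNIV_option:
  fixes f :: "'n::finite option \<Rightarrow> 'a::comm_monoid_mult"
  shows "(\<Prod>x\<in>UNIV. f x) = f None * (\<Prod>i\<in>UNIV. f (Some i))"
  by (simp add: UNIV_option_conv prod.reindex)

lemma sum_UNIV_option:
  fixes f :: "'n::finite option \<Rightarrow> 'a::comm_monoid_add"
  shows "(\<Sum>x\<in>UNIV. f x) = f None + (\<Sum>i\<in>UNIV. f (Some i))"
  by (simp add: UNIV_option_conv sum.reindex)

lemma max_dist_rational_point_le_iff:
  assumes "1 \<le> q"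
  shows "max_dist (rational_point p q) z \<le> r
    \<longleftrightarrow> (\<forall>i. \<bar>real_of_int (p $ i) - real q * z $ i\<bar> \<le> real q * r)"
proof -
  have "\<bar>real_of_int (p $ i) / real q - z $ i\<bar> \<le> r
      \<longleftrightarrow> \<bar>real_of_int (p $ i) - real q * z $ i\<bar> \<le> real q * r" for i
  proof -
    have "real_of_int (p $ i) - real q * z $ i = real q * (real_of_int (p $ i) / real q - z $ i)"
      using assms by (simp add: field_simps)
    then show ?thesis using assms by (simp add: abs_mult)
  qed
  then show ?thesis by (simp add: max_dist_le_iff rational_point_def)
qed

text \<open>Projective coordinates of p/q. The index type \<open>'n option\<close> has one extra
  index \<open>None\<close> for the denominator, so that n + 1 rational points give a square
  matrix.\<close>

definition homogeneous :: "int ^ 'n \<Rightarrow> nat \<Rightarrow> real ^ ('n option)" where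
  "homogeneous p q = (\<chi> k. case k of None \<Rightarrow> real q | Some i \<Rightarrow> real_of_int (p $ i))"

(* Subtracting z times the row of denominators leaves rows with entries at most q * r, so the
   integer determinant is less than 1 in absolute value. *)
lemma det_homogeneous_eq_0:
  fixes p :: "'n option \<Rightarrow> int ^ 'n::finite" and q :: "'n option \<Rightarrow> nat"
  assumes q: "\<And>k. 1 \<le> q k"
    and dist: "\<And>k. max_dist (rational_point (p k) (q k)) z \<le> r"
    and r: "0 \<le> r"
    and small: "fact (CARD('n) + 1) * (\<Prod>k\<in>UNIV. real (q k)) * r ^ CARD('n) < 1"
  shows "det (\<chi> i k. homogeneous (p k) (q k) $ i) = 0"
proof -
  let ?A = "(\<chi> i k. homogeneous (p k) (q k) $ i) :: real ^ 'n option ^ 'n option"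
  let ?T = "range (Some :: 'n \<Rightarrow> 'n option)"
  define c where "c = (\<lambda>k :: 'n option. case k of None \<Rightarrow> 0 | Some i \<Rightarrow> - z $ i)"
  define M where "M = (\<chi> k. if k \<in> ?T then row k ?A + c k *s row None ?A else row k ?A)"
  have detM: "det M = det ?A"
    unfolding M_def by (rule det_add_multiples_of_row) auto
  define w where "w = (\<lambda>i :: 'n option. case i of None \<Rightarrow> 1 | Some _ \<Rightarrow> r)"
  have M_le: "\<bar>M $ i $ k\<bar> \<le> real (q k) * w i" for i k
  proof (cases i)
    case None
    then show ?thesis by (simp add: M_def row_def homogeneous_def w_def image_iff)
  next
    case (Some j)
    have "\<bar>real_of_int (p k $ j) - real (q k) * z $ j\<bar> \<le> real (q k) * r"
      using dist[of k] max_dist_rational_point_le_iff[OF q[of k]] by blast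
    then show ?thesis using Some by (simp add: M_def row_def homogeneous_def w_def c_def algebra_simps)
  qed
  have term_le: "\<bar>of_int (sign \<pi>) * (\<Prod>i\<in>UNIV. M $ i $ \<pi> i)\<bar> \<le> (\<Prod>k\<in>UNIV. real (q k)) * r ^ CARD('n)"
    if "\<pi> permutes UNIV" for \<pi> :: "'n option \<Rightarrow> 'n option"
  proof -
    have "\<bar>of_int (sign \<pi>) * (\<Prod>i\<in>UNIV. M $ i $ \<pi> i)\<bar> = (\<Prod>i\<in>UNIV. \<bar>M $ i $ \<pi> i\<bar>)"
      by (simp add: abs_mult abs_prod sign_def)
    also have "\<dots> \<le> (\<Prod>i\<in>UNIV. real (q (\<pi> i)) * w i)"
      using M_le by (intro prod_mono) auto
    also have "\<dots> = (\<Prod>i\<in>UNIV. real (q (\<pi> i))) * (\<Prod>i\<in>UNIV. w i)"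
      by (rule prod.distrib)
    also have "(\<Prod>i\<in>UNIV. real (q (\<pi> i))) = (\<Prod>k\<in>UNIV. real (q k))"
      using prod.permute[OF that, of "\<lambda>k. real (q k)"] by (simp add: comp_def)
    also have "(\<Prod>i\<in>UNIV. w i) = r ^ CARD('n)"
      by (simp add: prod_UNIV_option w_def)
    finally show ?thesis .
  qed
  have "\<bar>det M\<bar> \<le> (\<Sum>\<pi>\<in>{\<pi>. \<pi> permutes (UNIV :: 'n option set)}.
      \<bar>of_int (sign \<pi>) * (\<Prod>i\<in>UNIV. M $ i $ \<pi> i)\<bar>)"
    unfolding det_def by (rule sum_abs)
  also have "\<dots> \<le> (\<Sum>\<pi>\<in>{\<pi>. \<pi> permutes (UNIV :: 'n option set)}.
      (\<Prod>k\<in>UNIV. real (q k)) * r ^ CARD('n))"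
    using term_le by (intro sum_mono) auto
  also have "\<dots> = fact (CARD('n) + 1) * (\<Prod>k\<in>UNIV. real (q k)) * r ^ CARD('n)"
    by (simp add: card_permutations[OF refl finite_class.finite_UNIV] card_UNIV_option algebra_simps)
  finally have "\<bar>det ?A\<bar> < 1" using small detM by simp
  moreover have "det ?A \<in> \<int>"
  proof -
    have "?A $ i $ k \<in> \<int>" for i k
      by (cases i) (auto simp: homogeneous_def)
    then show ?thesis unfolding det_def by (intro Ints_sum Ints_mult Ints_prod) auto
  qed
  ultimately show ?thesis by (metis Ints_nonzero_abs_less1)
qed

text \<open>If the homogeneous vectors spanned the space, a basis of them through the vector of
  \<open>(p0, q0)\<close> would have non-zero determinant, against
  \<open>det_homogeneous_eq_0\<close>. Keeping \<open>q0\<close> apart from the common bound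
  \<open>T\<close> matters when one denominator is much smaller than the others; powers n + 1 occur
  because \<open>T\<close> bounds these powers.\<close>

lemma rational_points_on_hyperplane:
  fixes S :: "((int ^ 'n::finite) \<times> nat) set" and z :: "real ^ 'n"
  assumes S: "\<And>p q. (p, q) \<in> S \<Longrightarrow> 1 \<le> q \<and> real q ^ (CARD('n) + 1) \<le> T
      \<and> max_dist (rational_point p q) z \<le> r"
    and base: "(p0, q0) \<in> S" and r: "0 \<le> r"
    and small: "real q0 ^ (CARD('n) + 1) * T ^ CARD('n)
        * (fact (CARD('n) + 1) * r ^ CARD('n)) ^ (CARD('n) + 1) < 1"
  obtains a :: "real ^ 'n" and b where "a \<noteq> 0"
    "\<And>p q. (p, q) \<in> S \<Longrightarrow> a \<bullet> rational_point p q = b"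
proof -
  let ?n = "CARD('n)"
  let ?v = "\<lambda>x. homogeneous (fst x) (snd x)"
  have ineq: "span (?v ` S) \<noteq> UNIV"
  proof
    assume span: "span (?v ` S) = UNIV"
    have v0: "?v (p0, q0) \<noteq> 0"
    proof
      assume "?v (p0, q0) = 0"
      then have "?v (p0, q0) $ None = 0" by simp
      then show False using S[OF base] by (simp add: homogeneous_def)
    qed
    have "{?v (p0, q0)} \<subseteq> ?v ` S" using base by blast
    moreover have "independent {?v (p0, q0)}" using v0 by simp
    \<comment> \<open>The basis is extended from \<open>(p0, q0)\<close> so that the factor
      \<open>q0\<close> really occurs in the product of denominators.\<close>
    ultimately obtain B where B: "{?v (p0, q0)} \<subseteq> B" "B \<subseteq> ?v ` S" "independent B" "?v ` S \<subseteq> span B"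
      by (rule maximal_independent_subset_extend)
    have spanB: "span B = UNIV" using span_mono[OF B(4)] span by (simp add: span_span top.extremum_unique)
    have finB: "finite B" using B(3) independent_imp_finite by blast
    have "card B = DIM(real ^ 'n option)" using dim_span_eq_card_independent[OF B(3)] spanB
      by simp
    then have "card B = card (UNIV :: 'n option set)" by simp
    then obtain f where f: "bij_betw f (UNIV :: 'n option set) B"
      using finB by (metis finite_class.finite_UNIV finite_same_card_bij)
    then obtain k0 where k0: "f k0 = ?v (p0, q0)"
      using B(1) by (metis bij_betw_iff_bijections insert_subset)
    have "\<exists>x. x \<in> S \<and> f k = ?v x \<and> (k = k0 \<longrightarrow> x = (p0, q0))" for k
    proof (cases "k = k0")
      case False
      have "f k \<in> B" using f by (auto simp: bij_betw_def)
      then have "f k \<in> ?v ` S" using B(2) by blast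
      then show ?thesis using False by blast
    qed (use k0 base in auto)
    then obtain g where g: "\<And>k. g k \<in> S" "\<And>k. f k = ?v (g k)" "g k0 = (p0, q0)" by metis
    let ?A = "(\<chi> i k. homogeneous (fst (g k)) (snd (g k)) $ i) :: real ^ 'n option ^ 'n option"
    have gS: "1 \<le> snd (g k)" "real (snd (g k)) ^ (?n + 1) \<le> T"
      "max_dist (rational_point (fst (g k)) (snd (g k))) z \<le> r" for k
      using S[of "fst (g k)" "snd (g k)"] g(1)[of k] by auto
    let ?P = "\<Prod>k\<in>UNIV. real (snd (g k))"
    have "?P ^ (?n + 1) = (\<Prod>k\<in>UNIV. real (snd (g k)) ^ (?n + 1))"
      by (rule prod_power_distrib)
    also have "\<dots> = real q0 ^ (?n + 1) * (\<Prod>k\<in>UNIV - {k0}. real (snd (g k)) ^ (?n + 1))"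
      using prod.remove[of UNIV k0 "\<lambda>k. real (snd (g k)) ^ (?n + 1)"] by (simp only: g(3) snd_conv finite_class.finite_UNIV UNIV_I)
    also have "\<dots> \<le> real q0 ^ (?n + 1) * (\<Prod>k\<in>UNIV - {k0}. T)"
      using gS by (intro mult_left_mono prod_mono) auto
    also have "\<dots> = real q0 ^ (?n + 1) * T ^ ?n"
      by (simp add: card_UNIV_option)
    finally have "?P ^ (?n + 1) * (fact (?n + 1) * r ^ ?n) ^ (?n + 1) < 1"
      using small mult_right_mono[of "?P ^ (?n + 1)" "real q0 ^ (?n + 1) * T ^ ?n"
        "(fact (?n + 1) * r ^ ?n) ^ (?n + 1)"] r by (meson le_less_trans zero_le_power fact_ge_zero mult_nonneg_nonneg)
    moreover have "fact (?n + 1) * ?P * r ^ ?n = ?P * (fact (?n + 1) * r ^ ?n)" by (simp only: ac_simps)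
    ultimately have "(fact (?n + 1) * ?P * r ^ ?n) ^ (?n + 1) < 1"
      by (simp only: power_mult_distrib)
    then have "fact (?n + 1) * ?P * r ^ ?n < 1"
      by (meson linorder_not_less one_le_power)
    with gS r have "det ?A = 0"
      by (intro det_homogeneous_eq_0) auto
    moreover have "columns ?A = B"
    proof -
      have "column k ?A = f k" for k by (simp add: column_def g(2) vec_eq_iff)
      then show ?thesis using f by (auto simp: columns_def bij_betw_def)
    qed
    then have "\<exists>X. ?A ** X = mat 1"
      unfolding matrix_right_invertible_span_columns span_vec_eq using spanB by simp
    then have "det ?A \<noteq> 0"
      using invertible_det_nz invertible_right_inverse by blast
    ultimately show False by simp
  qed
  then obtain a' where a': "a' \<noteq> 0" "span (?v ` S) \<subseteq> {x. a' \<bullet> x = 0}"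
    using span_not_univ_subset_hyperplane by blast
  \<comment> \<open>The entry \<open>a' $ None\<close> becomes the constant term of the hyperplane.
    If \<open>a\<close> were zero, the equation at \<open>(p0, q0)\<close> would force this entry to
    be zero too.\<close>
  define a where "a = (\<chi> i. a' $ Some i)"
  have eq: "a \<bullet> (\<chi> i. real_of_int (p $ i)) + a' $ None * real q = 0" if "(p, q) \<in> S" for p q
  proof -
    have "?v (p, q) \<in> span (?v ` S)" using that by (intro span_base imageI)
    then have "a' \<bullet> homogeneous p q = 0" using a'(2) by auto
    then show ?thesis
      by (simp add: inner_vec_def sum_UNIV_option homogeneous_def a_def)
  qed
  show thesis
  proof (rule that)
    show "a \<noteq> 0"
    proof
      assume "a = 0"
      with eq[OF base] S[OF base] have "a' $ None = 0" by simp
      moreover have "a' $ Some i = 0" for i using \<open>a = 0\<close> by (simp add: a_def vec_eq_iff)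
      ultimately have "a' $ k = 0" for k by (cases k) auto
      then show False using a'(1) by (simp add: vec_eq_iff)
    qed
    show "a \<bullet> rational_point p q = - a' $ None" if "(p, q) \<in> S" for p q
    proof -
      have "rational_point p q = (1 / real q) *\<^sub>R (\<chi> i. real_of_int (p $ i))"
        by (simp add: rational_point_def vec_eq_iff)
      then have "a \<bullet> rational_point p q = (1 / real q) * (a \<bullet> (\<chi> i. real_of_int (p $ i)))"
        by simp
      also have "\<dots> = - a' $ None"
        using eq[OF that] S[OF that] by (simp add: field_simps)
      finally show ?thesis .
    qed
  qed
qed

(* The hyperplane through the points of S misses one of the open orthants at z. *)
lemma rational_points_avoid_orthant:
  fixes S :: "((int ^ 'n::finite) \<times> nat) set" and z :: "real ^ 'n"
  assumes S: "\<And>p q. (p, q) \<in> S \<Longrightarrow> 1 \<le> q \<and> real q ^ (CARD('n) + 1) \<le> T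
      \<and> max_dist (rational_point p q) z \<le> r"
    and base: "S \<noteq> {} \<Longrightarrow> \<exists>p0 q0. (p0, q0) \<in> S \<and> real q0 ^ (CARD('n) + 1) * T ^ CARD('n)
        * (fact (CARD('n) + 1) * r ^ CARD('n)) ^ (CARD('n) + 1) < 1"
    and r: "0 \<le> r"
  obtains \<sigma> :: "'n \<Rightarrow> real" where "\<And>i. \<sigma> i = 1 \<or> \<sigma> i = - 1"
    "\<And>y t p q. (\<And>i. t \<le> \<sigma> i * (y $ i - z $ i)) \<Longrightarrow> (p, q) \<in> S
        \<Longrightarrow> t \<le> max_dist y (rational_point p q)"
proof (cases "S = {}")
  case True
  then show thesis by (intro that[of "\<lambda>_. 1"]) auto
next
  case False
  with base obtain p0 q0 where "(p0, q0) \<in> S" "real q0 ^ (CARD('n) + 1) * T ^ CARD('n)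
        * (fact (CARD('n) + 1) * r ^ CARD('n)) ^ (CARD('n) + 1) < 1" by blast
  then obtain a0 :: "real ^ 'n" and b0 where a0: "a0 \<noteq> 0"
    "\<And>p q. (p, q) \<in> S \<Longrightarrow> a0 \<bullet> rational_point p q = b0"
    using rational_points_on_hyperplane[OF S _ r] by metis
  obtain a :: "real ^ 'n" and b where a: "a \<noteq> 0" "b \<le> a \<bullet> z"
    "\<And>p q. (p, q) \<in> S \<Longrightarrow> a \<bullet> rational_point p q = b"
  proof (cases "b0 \<le> a0 \<bullet> z")
    case True
    then show ?thesis using a0 that by blast
  next
    case False
    then show ?thesis using a0 by (intro that[of "- a0" "- b0"]) auto
  qed
  \<comment> \<open>The normal has been oriented so that \<open>b \<le> a \<bullet> z\<close>;
    moving by the signs of its entries then leads away from the hyperplane in every coordinate. The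
    maximum norm is dual to the sum of the absolute entries of \<open>a\<close>, so no constant is
    lost.\<close>
  define \<sigma> where "\<sigma> = (\<lambda>i. if 0 \<le> a $ i then 1 else - 1 :: real)"
  have \<sigma>a: "\<sigma> i * a $ i = \<bar>a $ i\<bar>" for i by (simp add: \<sigma>_def)
  have pos: "0 < (\<Sum>i\<in>UNIV. \<bar>a $ i\<bar>)"
  proof -
    obtain j where "a $ j \<noteq> 0" using a(1) by (auto simp: vec_eq_iff)
    then show ?thesis by (intro sum_pos2[of _ j]) auto
  qed
  show thesis
  proof (rule that)
    show "\<sigma> i = 1 \<or> \<sigma> i = - 1" for i by (simp add: \<sigma>_def)
    fix y t p q assume t: "\<And>i. t \<le> \<sigma> i * (y $ i - z $ i)" and pq: "(p, q) \<in> S"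
    let ?x = "rational_point p q"
    have "t * (\<Sum>i\<in>UNIV. \<bar>a $ i\<bar>) = (\<Sum>i\<in>UNIV. \<bar>a $ i\<bar> * t)"
      by (simp add: sum_distrib_left mult.commute)
    also have "\<dots> \<le> (\<Sum>i\<in>UNIV. \<bar>a $ i\<bar> * (\<sigma> i * (y $ i - z $ i)))"
      using t by (intro sum_mono mult_left_mono) auto
    also have "\<dots> = (\<Sum>i\<in>UNIV. a $ i * (y $ i - z $ i))"
      by (intro sum.cong) (auto simp: \<sigma>_def)
    also have "\<dots> = a \<bullet> y - a \<bullet> z"
      by (simp add: inner_vec_def right_diff_distrib sum_subtractf)
    also have "\<dots> \<le> a \<bullet> y - a \<bullet> ?x" using a(2) a(3)[OF pq] by simp
    also have "\<dots> = (\<Sum>i\<in>UNIV. a $ i * (y $ i - ?x $ i))"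
      by (simp add: inner_vec_def right_diff_distrib sum_subtractf)
    also have "\<dots> \<le> (\<Sum>i\<in>UNIV. \<bar>a $ i\<bar> * max_dist y ?x)"
    proof (intro sum_mono)
      fix i
      have "a $ i * (y $ i - ?x $ i) \<le> \<bar>a $ i\<bar> * \<bar>y $ i - ?x $ i\<bar>"
        by (metis abs_ge_self abs_mult)
      also have "\<dots> \<le> \<bar>a $ i\<bar> * max_dist y ?x"
        using abs_component_le_max_dist[of y i ?x] by (intro mult_left_mono) auto
      finally show "a $ i * (y $ i - ?x $ i) \<le> \<bar>a $ i\<bar> * max_dist y ?x" .
    qed
    also have "\<dots> = max_dist y ?x * (\<Sum>i\<in>UNIV. \<bar>a $ i\<bar>)"
      by (simp add: sum_distrib_left mult.commute)
    finally show "t \<le> max_dist y ?x" using pos by simp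
  qed
qed

section \<open>Isolated rational approximations\<close>

lemma finite_near_rationals:
  fixes x :: "real ^ 'n::finite"
  shows "finite {(p, q). 1 \<le> q \<and> q \<le> Q \<and> max_dist x (rational_point p q) \<le> M}"
proof -
  define B where "B = \<lceil>real Q * (\<bar>M\<bar> + infnorm x)\<rceil>"
  have "{(p, q). 1 \<le> q \<and> q \<le> Q \<and> max_dist x (rational_point p q) \<le> M}
      \<subseteq> {p. \<forall>i. \<bar>p $ i\<bar> \<le> B} \<times> {..Q}"
  proof
    fix w assume "w \<in> {(p, q). 1 \<le> q \<and> q \<le> Q \<and> max_dist x (rational_point p q) \<le> M}"
    then obtain p :: "int ^ 'n" and q where w: "w = (p, q)" and q: "1 \<le> q" "q \<le> Q"
      and d: "max_dist x (rational_point p q) \<le> M" by blast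
    have "\<bar>p $ i\<bar> \<le> B" for i
    proof -
      have "\<bar>x $ i - real_of_int (p $ i) / real q\<bar> \<le> M"
        using d abs_component_le_max_dist[of x i "rational_point p q"]
        by (simp add: rational_point_def)
      moreover have "\<bar>x $ i\<bar> \<le> infnorm x" by (rule component_le_infnorm_cart)
      ultimately have "\<bar>real_of_int (p $ i) / real q\<bar> \<le> \<bar>M\<bar> + infnorm x" by linarith
      then have "\<bar>real_of_int (p $ i)\<bar> \<le> real q * (\<bar>M\<bar> + infnorm x)"
        using q by (simp add: abs_divide field_simps)
      also have "\<dots> \<le> real Q * (\<bar>M\<bar> + infnorm x)"
        using q infnorm_pos_le[of x] by (intro mult_right_mono) auto
      finally have "real_of_int \<bar>p $ i\<bar> \<le> real Q * (\<bar>M\<bar> + infnorm x)" by simp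
      then show ?thesis unfolding B_def by linarith
    qed
    then show "w \<in> {p. \<forall>i. \<bar>p $ i\<bar> \<le> B} \<times> {..Q}" using q w by simp
  qed
  then show ?thesis by (rule finite_subset) (simp add: finite_int_box(1))
qed

text \<open>Dirichlet's theorem for denominators up to \<open>N ^ n \<le> Q\<close>, where
  \<open>N\<close> is the integer part of the n-th root of \<open>Q\<close>; the factor 2 pays for
  the rounding.\<close>

lemma Dirichlet_simultaneous:
  fixes x :: "real ^ 'n::finite" and Q :: nat
  assumes Q: "1 \<le> Q"
  obtains p q where "1 \<le> q" "q \<le> Q"
    "real q * max_dist x (rational_point p q) \<le> 2 * real Q powr (- 1 / real CARD('n))"
proof -
  let ?n = "CARD('n)"
  define y where "y = real Q powr (1 / real ?n)"
  define N where "N = nat \<lfloor>y\<rfloor>"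
  have y1: "1 \<le> y" using Q by (simp add: y_def ge_one_powr_ge_zero)
  have N: "0 < N" "real N \<le> y" "y < real N + 1" using y1 by (auto simp: N_def)
  have "real N ^ ?n \<le> y ^ ?n" using N by (intro power_mono) auto
  also have "y ^ ?n = real Q"
    using Q by (simp add: y_def powr_powr powr_realpow[symmetric])
  finally have NQ: "N ^ ?n \<le> Q" by (metis of_nat_le_iff of_nat_power)
  obtain e :: "nat \<Rightarrow> 'n" where e: "bij_betw e {..<?n} UNIV"
    using ex_bij_betw_nat_finite[of "UNIV :: 'n set"] by (auto simp: atLeast0LessThan)
  obtain q p where qp: "0 < q" "q \<le> int (N ^ ?n)"
    "\<And>i. i < ?n \<Longrightarrow> \<bar>of_int q * x $ e i - of_int (p i)\<bar> < 1 / real N"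
    using Dirichlet_approx_simult[OF N(1), of ?n "\<lambda>i. x $ e i"] by metis
  define P where "P = (\<chi> i. p (the_inv_into {..<?n} e i))"
  have q1: "1 \<le> nat q" using qp(1) by simp
  have "\<bar>real_of_int (P $ i) - real (nat q) * x $ i\<bar> \<le> real (nat q) * (1 / (real N * real (nat q)))" for i
  proof -
    have inj: "inj_on e {..<?n}" and i: "i \<in> e ` {..<?n}" using e by (auto simp: bij_betw_def)
    have "the_inv_into {..<?n} e i < ?n" using the_inv_into_into[OF inj i order_refl] by simp
    from qp(3)[OF this] show ?thesis
      using qp(1) by (simp add: P_def f_the_inv_into_f[OF inj i] abs_minus_commute)
  qed
  then have "max_dist (rational_point P (nat q)) x \<le> 1 / (real N * real (nat q))"
    using max_dist_rational_point_le_iff[OF q1] by blast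
  then have "real (nat q) * max_dist x (rational_point P (nat q)) \<le> 1 / real N"
    using qp(1) mult_left_mono[of "max_dist (rational_point P (nat q)) x" _ "real (nat q)"]
    by (fastforce simp: max_dist_sym[of x])
  also have "1 \<le> real N" using N(1) by simp
  then have "y \<le> 2 * real N" using N by linarith
  then have "1 / real N \<le> 2 / y" using divide_left_mono[of y "2 * real N" 2] N(1) y1 by simp
  also have "\<dots> = 2 * real Q powr (- 1 / real ?n)" by (simp add: y_def powr_minus_divide)
  finally have bound: "real (nat q) * max_dist x (rational_point P (nat q)) \<le> 2 * real Q powr (- 1 / real ?n)" .
  have "q \<le> int Q" using qp(2) NQ by (meson of_nat_le_iff order_trans)
  then show thesis using q1 bound by (intro that[of "nat q" P]) auto
qed

(* p/q minimises a weighted sum of the distance to x and the denominator. A nearby p'/q' with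
   q - q' large would make this sum smaller, and for q - q' small the point (p - p') / (q - q')
   would violate the assumption on x. *)
lemma isolated_rational_approximation:
  fixes x :: "real ^ 'n::finite" and Q :: nat
  assumes Q: "1 \<le> Q" and \<eta>: "0 < \<eta>" "\<eta> \<le> 1 / 2"
    and h_def: "h = real Q powr (- 1 / real CARD('n))"
    and bad: "\<And>v j. 1 \<le> j \<Longrightarrow> real j < \<eta> * real Q
      \<Longrightarrow> 4 * h \<le> real j * max_dist x (rational_point v j)"
  obtains p q where "1 \<le> q" "q \<le> Q" "\<eta> * real Q \<le> real q"
    "max_dist x (rational_point p q) \<le> (2 / \<eta> + 1) * h / real Q"
    "\<And>p' q'. 1 \<le> q' \<Longrightarrow> rational_point p' q' = rational_point p q \<Longrightarrow> q \<le> q'"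
    "\<And>p' q'. 1 \<le> q' \<Longrightarrow> q' \<le> q \<Longrightarrow> rational_point p' q' \<noteq> rational_point p q
      \<Longrightarrow> \<eta> * h / real Q \<le> max_dist (rational_point p q) (rational_point p' q')"
proof -
  have h: "0 < h" "h \<le> 1" using Q by (auto simp: h_def powr_le1 ge_one_powr_ge_zero powr_minus_divide)
  \<comment> \<open>With this weight, denominators up to \<open>Q\<close> contribute at most
    \<open>h / Q\<close> to \<open>\<Phi>\<close>, the order of the distances that are to be
    expected.\<close>
  define \<mu> where "\<mu> = h / (real Q)\<^sup>2"
  have \<mu>: "0 < \<mu>" "\<mu> * real Q = h / real Q" using Q h by (auto simp: \<mu>_def power2_eq_square)
  define \<Phi> where "\<Phi> = (\<lambda>(p :: int ^ 'n, q). max_dist x (rational_point p q) + \<mu> * real q)"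
  obtain p0 q0 where q0: "1 \<le> q0" "q0 \<le> Q"
    "real q0 * max_dist x (rational_point p0 q0) \<le> 2 * h"
    using Dirichlet_simultaneous[OF Q, of x] h_def by metis
  \<comment> \<open>Pairs outside \<open>S\<close> exceed \<open>\<Phi> (p0, q0)\<close> by their
    distance alone, so a minimum over this finite set is one over all denominators up to
    \<open>Q\<close>.\<close>
  define S where "S = {(p, q). 1 \<le> q \<and> q \<le> Q \<and> max_dist x (rational_point p q) \<le> \<Phi> (p0, q0)}"
  have "finite S" unfolding S_def by (rule finite_near_rationals)
  moreover have S0: "(p0, q0) \<in> S" using q0 \<mu> by (simp add: S_def \<Phi>_def)
  ultimately obtain p q where pq: "(p, q) \<in> S" "\<And>z. z \<in> S \<Longrightarrow> \<Phi> (p, q) \<le> \<Phi> z"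
    using arg_min_if_finite[of S \<Phi>] by (metis empty_iff linorder_not_le surj_pair)
  have q: "1 \<le> q" "q \<le> Q" using pq(1) by (auto simp: S_def)
  have min: "\<Phi> (p, q) \<le> \<Phi> (p', q')" if "1 \<le> q'" "q' \<le> Q" for p' q'
  proof (cases "(p', q') \<in> S")
    case False
    then have "\<Phi> (p0, q0) \<le> max_dist x (rational_point p' q')" using that by (simp add: S_def)
    also have "\<dots> \<le> \<Phi> (p', q')" using \<mu> by (simp add: \<Phi>_def)
    finally show ?thesis using pq(2)[OF S0] by simp
  qed (rule pq(2))
  let ?D = "max_dist x (rational_point p q)"
  have q0\<eta>: "\<eta> * real Q \<le> real q0" using bad[OF q0(1), of p0] q0(3) h by linarith
  have D: "?D \<le> (2 / \<eta> + 1) * h / real Q"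
  proof -
    have "?D \<le> \<Phi> (p, q)" using \<mu> by (simp add: \<Phi>_def)
    also have "\<dots> \<le> \<Phi> (p0, q0)" by (rule pq(2)[OF S0])
    also have "\<dots> \<le> 2 * h / real q0 + \<mu> * real Q"
    proof -
      have "max_dist x (rational_point p0 q0) \<le> 2 * h / real q0"
        using q0 by (simp add: field_simps)
      moreover have "\<mu> * real q0 \<le> \<mu> * real Q" using q0 \<mu>(1) by simp
      ultimately show ?thesis by (simp add: \<Phi>_def)
    qed
    also have "\<dots> \<le> 2 * h / (\<eta> * real Q) + h / real Q"
      unfolding \<mu>(2) using q0\<eta> Q q0(1) \<eta> h
      by (intro add_right_mono divide_left_mono mult_pos_pos) auto
    also have "\<dots> = (2 / \<eta> + 1) * h / real Q"
      using Q \<eta> by (simp add: add_divide_distrib distrib_right)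
    finally show ?thesis .
  qed
  have jD: "j * ?D \<le> (2 + \<eta>) * h" if "0 \<le> j" "j \<le> \<eta> * real Q" for j
  proof -
    have "j * ?D \<le> (\<eta> * real Q) * ((2 / \<eta> + 1) * h / real Q)"
      using that D by (intro mult_mono) auto
    also have "\<dots> = (2 + \<eta>) * h" using \<eta> Q by (simp add: field_simps)
    finally show ?thesis .
  qed
  have small: "(2 + \<eta>) * h < 4 * h" using \<eta> h by (intro mult_strict_right_mono) auto
  have q\<eta>: "\<eta> * real Q \<le> real q"
  proof (rule ccontr)
    assume "\<not> ?thesis"
    then have "real q < \<eta> * real Q" by simp
    with bad[OF q(1) this, of p] jD[of "real q"] small show False by linarith
  qed
  show thesis
  proof (rule that[OF q q\<eta> D])
    fix p' :: "int ^ 'n" and q' :: nat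
    assume q': "1 \<le> q'" and eq: "rational_point p' q' = rational_point p q"
    show "q \<le> q'"
    proof (rule ccontr)
      assume "\<not> q \<le> q'"
      then have "q' < q" by simp
      with min[of q' p'] q' q have "\<mu> * real q \<le> \<mu> * real q'" by (simp add: \<Phi>_def eq)
      then show False using \<mu> \<open>q' < q\<close> by simp
    qed
  next
    fix p' :: "int ^ 'n" and q' :: nat
    assume q': "1 \<le> q'" "q' \<le> q" and neq: "rational_point p' q' \<noteq> rational_point p q"
    let ?d = "max_dist (rational_point p q) (rational_point p' q')"
    define j where "j = q - q'"
    consider "j = 0" | "1 \<le> j" "real j < \<eta> * real Q" | "\<eta> * real Q \<le> real j" by linarith
    then show "\<eta> * h / real Q \<le> ?d"
    proof cases
      case 1
      then have qq: "q' = q" using q' by (simp add: j_def)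
      with neq obtain i where i: "p $ i \<noteq> p' $ i" by (metis vec_eq_iff)
      have "\<eta> * h \<le> 1 * 1" using \<eta> h by (intro mult_mono) auto
      then have "\<eta> * h / real Q \<le> 1 / real q" using q \<eta> h by (intro frac_le) auto
      also have "1 \<le> \<bar>p $ i - p' $ i\<bar>" using i by linarith
      then have "1 \<le> \<bar>real_of_int (p $ i) - real_of_int (p' $ i)\<bar>"
        by (metis of_int_1_le_iff of_int_abs of_int_diff)
      then have "1 / real q \<le> \<bar>real_of_int (p $ i) - real_of_int (p' $ i)\<bar> / real q"
        by (rule divide_right_mono) simp
      also have "\<dots> = \<bar>rational_point p q $ i - rational_point p' q' $ i\<bar>"
        by (simp add: rational_point_def qq abs_divide diff_divide_distrib[symmetric])
      also have "\<dots> \<le> ?d" by (rule abs_component_le_max_dist)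
      finally show ?thesis .
    next
      case 2
      define v where "v = p - p'"
      have eqs: "real q = real q' + real j" "p = p' + v" using q' by (auto simp: j_def v_def)
      have "rational_point p q - rational_point p' q'
          = (real j / real q') *\<^sub>R (rational_point v j - rational_point p q)"
        using q q' 2 unfolding vec_eq_iff rational_point_def eqs
        by (simp add: divide_simps) (simp add: algebra_simps)
      then have "?d = (real j / real q') * max_dist (rational_point v j) (rational_point p q)"
        by (simp add: max_dist_def infnorm_mul)
      also have "\<dots> \<ge> (real j / real q') * (max_dist x (rational_point v j) - ?D)"
        using max_dist_triangle[of x "rational_point v j" "rational_point p q"]
        by (intro mult_left_mono) (auto simp: max_dist_sym[of "rational_point p q"])
      finally have "(real j * max_dist x (rational_point v j) - real j * ?D) / real q' \<le> ?d"
        by (simp add: right_diff_distrib diff_divide_distrib)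
      moreover have "\<eta> * h \<le> real j * max_dist x (rational_point v j) - real j * ?D"
      proof -
        have "\<eta> * h \<le> 1 / 2 * h" using \<eta> h by (intro mult_right_mono) auto
        moreover have "(2 + \<eta>) * h = 2 * h + \<eta> * h" by (simp add: distrib_right)
        moreover have "real j * ?D \<le> (2 + \<eta>) * h" using 2 by (intro jD) auto
        ultimately show ?thesis using bad[OF 2, of v] h(1) by argo
      qed
      then have "\<eta> * h / real Q \<le> (real j * max_dist x (rational_point v j) - real j * ?D) / real q'"
        using q' q mult_pos_pos[OF \<eta>(1) h(1)] by (intro frac_le) (linarith | simp)+
      ultimately show ?thesis by linarith
    next
      case 3
      have "\<eta> * h / real Q = \<mu> * (\<eta> * real Q)" using \<mu>(2) by (simp add: mult.commute mult.left_commute)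
      also have "\<dots> \<le> \<mu> * real j" using 3 \<mu> by (intro mult_left_mono) auto
      also have "\<dots> = \<mu> * real q - \<mu> * real q'" using q' by (simp add: j_def of_nat_diff algebra_simps)
      also have "\<dots> \<le> max_dist x (rational_point p' q') - ?D"
        using min[of q' p'] q' q by (simp add: \<Phi>_def)
      also have "\<dots> \<le> ?d" using max_dist_triangle[of x "rational_point p' q'" "rational_point p q"] by simp
      finally show ?thesis .
    qed
  qed
qed

section \<open>A tree of cubes\<close>

definition cube :: "real ^ 'n \<Rightarrow> real \<Rightarrow> (real ^ 'n) set" where
  "cube z r = {y. max_dist y z \<le> r}"

lemma center_in_cube: "0 \<le> r \<Longrightarrow> z \<in> cube z r"
  by (simp add: cube_def)

lemma cube_mono: "r \<le> r' \<Longrightarrow> cube z r \<subseteq> cube z r'"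
  by (auto simp: cube_def)

text \<open>The denominators met near a chosen \<open>Q\<close> are only known to be at least a
  fixed fraction of \<open>Q\<close>, so a condition is needed for all of these at once.\<close>

lemma eventually_all_ge_scaled:
  fixes c :: real
  assumes "eventually P sequentially" "0 < c"
  shows "\<forall>\<^sub>F Q in sequentially. \<forall>q. c * real Q \<le> real q \<longrightarrow> P q"
proof -
  obtain N where N: "\<And>q. N \<le> q \<Longrightarrow> P q" using assms(1) by (auto simp: eventually_sequentially)
  have "\<forall>\<^sub>F Q in sequentially. real N / c \<le> real Q"
    by (rule filterlim_real_sequentially[unfolded filterlim_at_top, rule_format])
  then show ?thesis
  proof eventually_elim
    case (elim Q)
    then have "real N \<le> c * real Q" using assms(2) by (simp add: field_simps)
    then show ?case using N by (meson of_nat_le_iff order_trans)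
  qed
qed

lemma eventually_powr_le:
  fixes e c :: real
  assumes "e < 0" "0 < c"
  shows "\<forall>\<^sub>F Q in sequentially. real Q powr e \<le> c"
proof -
  have "(\<lambda>Q. real Q powr e) \<longlonglongrightarrow> 0"
    using assms(1) filterlim_real_sequentially by (rule tendsto_neg_powr)
  then have "\<forall>\<^sub>F Q in sequentially. real Q powr e < c"
    using assms(2) by (rule order_tendstoD)
  then show ?thesis by eventually_elim simp
qed

text \<open>\<open>stage\<close> counts the prescribed approximations already made;
  \<open>goal\<close> is the number \<open>Q\<close> whose scale decides when the next one is
  made.\<close>

datatype 'n node = Node (center: "real ^ 'n") (radius: real) (stage: nat) (goal: nat)

abbreviation node_cube :: "'n::finite node \<Rightarrow> (real ^ 'n) set" where
  "node_cube v \<equiv> cube (center v) (radius v)"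

lemma compact_cube: "compact (cube (z :: real ^ 'n::finite) r)"
proof -
  have "cube z r = cbox (z - (\<chi> i. r)) (z + (\<chi> i. r))"
    by (auto simp: cube_def max_dist_le_iff mem_box_cart abs_le_iff algebra_simps)
  then show ?thesis by simp
qed

text \<open>\<open>G\<close> is the number of subcubes per axis and \<open>s\<close> the exponent
  for which the limit set gets positive measure. The larger \<open>s'\<close> carries the slack: by
  \<open>branching\<close>, a subdivision into \<open>G ^ n\<close> cubes of radius smaller by
  \<open>4 * G\<close> keeps a mass bound of exponent \<open>s'\<close>, and the strict
  \<open>exponents\<close> pays for the jump from radius about \<open>Q powr (- \<alpha>)\<close> to
  about \<open>Q powr (- \<tau>)\<close>.\<close>

locale approximation_tree =
  fixes z0 :: "real ^ 'n::finite" and n :: nat and \<psi> :: "nat \<Rightarrow> real" and G :: nat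
    and s s' \<tau> :: real
  assumes dim: "n = CARD('n)"
    and psi_pos: "1 \<le> q \<Longrightarrow> 0 < \<psi> q"
    and psi_antimono: "1 \<le> q \<Longrightarrow> q \<le> q' \<Longrightarrow> \<psi> q' \<le> \<psi> q"
    and psi_small: "0 < \<nu> \<Longrightarrow>
      \<forall>\<^sub>F q in sequentially. \<psi> q \<le> \<nu> * real q powr (- ((real n + 1) / real n))"
    and psi_large: "\<exists>\<^sub>F Q in sequentially. real Q powr (- \<tau>) \<le> \<psi> Q"
    and G: "2 \<le> G"
    and s: "0 < s" "s \<le> s'"
    and branching: "(4 * real G) powr s' \<le> real G ^ n"
    and exponents: "\<tau> * s < (real n + 1) / real n * s'"
begin

lemmas avoid_orthant = rational_points_avoid_orthant[where 'n = 'n, folded dim]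
lemmas isolated_approximation = isolated_rational_approximation[where 'n = 'n, folded dim]

section \<open>Constants of the construction\<close>

definition "\<alpha> = (real n + 1) / real n"
definition "R = 4 * real G"
text \<open>Gives \<open>2 * b * R = 1 / (2 * fact (n + 1))\<close>, small enough for the
  determinant criterion in \<open>branches_exist\<close>. The denominators treated at radius
  \<open>r\<close> are those with \<open>r * real q powr \<alpha> \<le> b\<close>.\<close>

definition "b = 1 / (4 * R * fact (n + 1))"
text \<open>For denominators not yet treated at radius \<open>r\<close>, a distance of
  \<open>r / (2 * R)\<close> is at least \<open>\<kappa> * real q powr (- \<alpha>)\<close>.\<close>

definition "\<kappa> = b / (2 * R)"
text \<open>The n-th root of \<open>\<eta>\<close> is at most \<open>\<kappa> / 4\<close>. This
  turns bad approximability by denominators below \<open>\<eta> * real Q\<close> into the bound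
  asked for by \<open>isolated_rational_approximation\<close>.\<close>

definition "\<eta> = min (1 / 2) ((\<kappa> / 4) ^ n)"
text \<open>The distance constant in \<open>isolated_rational_approximation\<close>, where
  \<open>h / real Q = real Q powr (- \<alpha>)\<close>.\<close>

definition "A = 2 / \<eta> + 1"
text \<open>Below radius \<open>4 * A * R * real Q powr (- \<alpha>)\<close>, a denominator not yet
  treated is at least \<open>\<gamma> * real Q\<close>.\<close>

definition "\<gamma> = min \<eta> ((b / (4 * A * R)) powr (1 / \<alpha>))"

lemma n_pos: "0 < n" by (simp add: dim)

lemma alpha: "1 < \<alpha>" "0 < \<alpha>" "\<alpha> = 1 + 1 / real n"
  using n_pos by (auto simp: \<alpha>_def field_simps)

lemma R: "8 \<le> R" "0 < R" "1 < R" using G by (auto simp: R_def)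

lemma b: "0 < b" using R by (simp add: b_def)

lemma kappa: "0 < \<kappa>" using b R by (simp add: \<kappa>_def)

lemma eta: "0 < \<eta>" "\<eta> \<le> 1 / 2" "\<eta> \<le> (\<kappa> / 4) ^ n"
  using kappa by (auto simp: \<eta>_def)

lemma A: "5 \<le> A" "0 < A"
proof -
  have "4 \<le> 2 / \<eta>" using eta by (simp add: field_simps)
  then show "5 \<le> A" "0 < A" by (auto simp: A_def)
qed

lemma gamma: "0 < \<gamma>" "\<gamma> \<le> \<eta>" "\<gamma> powr \<alpha> \<le> b / (4 * A * R)"
proof -
  show g: "0 < \<gamma>" "\<gamma> \<le> \<eta>" using eta b A R by (auto simp: \<gamma>_def)
  have "\<gamma> powr \<alpha> \<le> ((b / (4 * A * R)) powr (1 / \<alpha>)) powr \<alpha>"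
    using g alpha by (intro powr_mono2) (auto simp: \<gamma>_def)
  also have "\<dots> = b / (4 * A * R)" using alpha b A R by (simp add: powr_powr)
  finally show "\<gamma> powr \<alpha> \<le> b / (4 * A * R)" .
qed

lemma powr_alpha_power: "1 \<le> q \<Longrightarrow> (real q powr \<alpha>) ^ n = real q ^ (n + 1)"
proof -
  assume "1 \<le> q"
  then have "(real q powr \<alpha>) ^ n = real q powr (\<alpha> * real n)"
    by (simp add: powr_powr[symmetric] powr_realpow)
  also have "\<alpha> * real n = real (n + 1)" using n_pos by (simp add: \<alpha>_def)
  finally show "(real q powr \<alpha>) ^ n = real q ^ (n + 1)"
    using \<open>1 \<le> q\<close> by (simp only: powr_realpow)
qed

lemma powr_minus_alpha: "1 \<le> Q \<Longrightarrow> real Q powr (- 1 / real n) / real Q = real Q powr (- \<alpha>)"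
  by (simp add: alpha(3) powr_diff powr_minus_divide)

text \<open>As \<open>\<alpha> * n = n + 1\<close>, taking n-th powers removes the real exponent and
  gives the bound in the form used by the hyperplane lemmas.\<close>

lemma power_le_of_height:
  assumes "1 \<le> q" "0 < r" "r * real q powr \<alpha> \<le> B"
  shows "real q ^ (n + 1) \<le> (B / r) ^ n"
proof -
  have "real q powr \<alpha> \<le> B / r" using assms by (simp add: field_simps)
  then have "(real q powr \<alpha>) ^ n \<le> (B / r) ^ n" by (intro power_mono) auto
  then show ?thesis using powr_alpha_power[OF assms(1)] by simp
qed

section \<open>Subdividing a cube away from rational points of bounded height\<close>

definition branches :: "real ^ 'n \<Rightarrow> real \<Rightarrow> (nat \<Rightarrow> real ^ 'n) \<Rightarrow> bool" where
  "branches z r ch \<longleftrightarrow>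
    (\<forall>d<G ^ n. cube (ch d) (r / R) \<subseteq> cube z r) \<and>
    (\<forall>d<G ^ n. \<forall>e<G ^ n. d \<noteq> e \<longrightarrow>
      (\<forall>y\<in>cube (ch d) (r / R). \<forall>y'\<in>cube (ch e) (r / R). 2 * (r / R) \<le> max_dist y y')) \<and>
    (\<forall>d<G ^ n. \<forall>y\<in>cube (ch d) (r / R). \<forall>p. \<forall>q\<ge>1.
      r / R * real q powr \<alpha> \<le> b \<longrightarrow> r / R \<le> max_dist y (rational_point p q))"

text \<open>Treated rational points within \<open>2 * r\<close> of \<open>z\<close> miss an open
  orthant at \<open>z\<close>, and the subcubes form a grid in that orthant, away from its faces.
  Rational points farther from \<open>z\<close> are at distance at least \<open>r\<close> from the
  whole cube.\<close>

lemma branches_exist: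
  assumes r: "0 < r"
  obtains ch where "branches z r ch"
proof -
  define S where "S = {(p :: int ^ 'n, q). 1 \<le> q \<and> r / R * real q powr \<alpha> \<le> b
    \<and> max_dist (rational_point p q) z \<le> 2 * r}"
  define T where "T = (b / (r / R)) ^ n"
  have T0: "0 \<le> T" using b r R by (simp add: T_def)
  have S: "1 \<le> q \<and> real q ^ (n + 1) \<le> T \<and> max_dist (rational_point p q) z \<le> 2 * r"
    if "(p, q) \<in> S" for p q
    using that power_le_of_height[of q "r / R" b] r R by (auto simp: S_def T_def)
  have base: "\<exists>p0 q0. (p0, q0) \<in> S \<and> real q0 ^ (n + 1) * T ^ n
      * (fact (n + 1) * (2 * r) ^ n) ^ (n + 1) < 1" if ne: "S \<noteq> {}"
  proof -
    obtain w where "w \<in> S" using ne by blast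
    then obtain p0 q0 where pq0: "(p0, q0) \<in> S" by (cases w) auto
    have "real q0 ^ (n + 1) * T ^ n * (fact (n + 1) * (2 * r) ^ n) ^ (n + 1)
        \<le> T * T ^ n * (fact (n + 1) * (2 * r) ^ n) ^ (n + 1)"
      using S[OF pq0] r T0 by (intro mult_right_mono) auto
    also have "\<dots> = (T * (fact (n + 1) * (2 * r) ^ n)) ^ (n + 1)"
      by (simp add: power_mult_distrib)
    also have "\<dots> < 1"
    proof -
      let ?f = "fact (n + 1) :: real"
      have f: "1 \<le> ?f" by (rule fact_ge_1)
      have "T * (?f * (2 * r) ^ n) = ?f * (2 * b * R) ^ n"
        using r by (simp add: T_def power_mult_distrib power_divide)
      also have "2 * b * R = 1 / (2 * ?f)" using R f unfolding b_def by simp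
      also have "(1 / (2 * ?f)) ^ n \<le> (1 / (2 * ?f)) ^ 1"
        using f n_pos by (intro power_decreasing) (auto simp: Suc_le_eq)
      finally have "T * (?f * (2 * r) ^ n) \<le> ?f * (1 / (2 * ?f))"
        using f by simp
      also have "\<dots> = 1 / 2" using f by simp
      finally show ?thesis using T0 r
        by (intro power_less_one_iff[THEN iffD2]) auto
    qed
    finally show ?thesis using pq0 by blast
  qed
  obtain \<sigma> :: "'n \<Rightarrow> real" where \<sigma>: "\<And>i. \<sigma> i = 1 \<or> \<sigma> i = - 1"
    "\<And>y t p q. (\<And>i. t \<le> \<sigma> i * (y $ i - z $ i)) \<Longrightarrow> (p, q) \<in> S
        \<Longrightarrow> t \<le> max_dist y (rational_point p q)"
    using avoid_orthant[OF S base] r by (metis less_eq_real_def mult_pos_pos zero_less_numeral)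
  let ?F = "Pi\<^sub>E (UNIV :: 'n set) (\<lambda>_. {..<G})"
  have "card ?F = G ^ n" by (simp add: card_PiE dim)
  moreover have "finite ?F" by (simp add: finite_PiE)
  ultimately obtain e where e: "bij_betw e {..<G ^ n} ?F"
    using ex_bij_betw_nat_finite[of ?F] by (auto simp: atLeast0LessThan)
  have eG: "e d i < G" if "d < G ^ n" for d i
    using e that by (auto simp: bij_betw_def)
  define u where "u = r / R"
  have u: "0 < u" "r = 4 * real G * u" using r R by (auto simp: u_def R_def)
  \<comment> \<open>In units of \<open>u\<close>, digit \<open>e\<close> occupies the interval from
    \<open>4 * e + 2\<close> to \<open>4 * e + 4\<close> along an axis. This leaves gaps of 2
    between neighbours and next to \<open>z\<close>, and the last interval ends at
    \<open>4 * G\<close>, a face of the big cube.\<close>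
  define ch where "ch = (\<lambda>d. \<chi> i. z $ i + \<sigma> i * ((3 + 4 * real (e d i)) * u))"
  have offset: "2 * u \<le> \<sigma> i * (y $ i - z $ i) \<and> \<bar>y $ i - z $ i\<bar> \<le> r"
    if d: "d < G ^ n" and y: "y \<in> cube (ch d) u" for d y i
  proof -
    have "\<bar>y $ i - ch d $ i\<bar> \<le> u" using y by (simp add: cube_def max_dist_le_iff)
    then have 1: "\<bar>(y $ i - z $ i) - \<sigma> i * ((3 + 4 * real (e d i)) * u)\<bar> \<le> u"
      by (simp add: ch_def algebra_simps)
    have "real (e d i) \<le> real G - 1" using eG[OF d, of i] by linarith
    then have "real (e d i) * u \<le> (real G - 1) * u" using u by (intro mult_right_mono) auto
    moreover define w where "w = real (e d i) * u"
    moreover define v where "v = real G * u"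
    ultimately have w: "0 \<le> w" "w \<le> v - u" and "r = 4 * v"
      using u by (auto simp: left_diff_distrib)
    have "(3 + 4 * real (e d i)) * u = 3 * u + 4 * w" by (simp add: w_def distrib_right)
    with 1 have "\<bar>(y $ i - z $ i) - \<sigma> i * (3 * u + 4 * w)\<bar> \<le> u" by simp
    with \<sigma>(1)[of i] w u(1) show ?thesis unfolding \<open>r = 4 * v\<close> by (auto simp: abs_le_iff)
  qed
  show thesis
  proof (rule that[of ch], unfold branches_def, intro conjI allI impI ballI)
    fix d assume d: "d < G ^ n"
    show "cube (ch d) (r / R) \<subseteq> cube z r"
      using offset[OF d] by (auto simp: u_def[symmetric] cube_def[of z] max_dist_le_iff)
  next
    fix d d' y y' assume d: "d < G ^ n" "d' < G ^ n" "d \<noteq> d'"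
      and y: "y \<in> cube (ch d) (r / R)" "y' \<in> cube (ch d') (r / R)"
    have "e d \<noteq> e d'" using e d by (auto simp: bij_betw_def inj_on_def)
    then obtain i where i: "e d i \<noteq> e d' i" by auto
    have "1 \<le> \<bar>real (e d i) - real (e d' i)\<bar>" using i by linarith
    then have "4 * u * 1 \<le> 4 * u * \<bar>real (e d i) - real (e d' i)\<bar>"
      using u by (intro mult_left_mono) auto
    also have "\<dots> = \<bar>\<sigma> i * (4 * u * (real (e d i) - real (e d' i)))\<bar>"
      using u \<sigma>(1)[of i] by (auto simp: abs_mult)
    also have "\<sigma> i * (4 * u * (real (e d i) - real (e d' i))) = ch d $ i - ch d' $ i"
      by (simp add: ch_def algebra_simps)
    also have "\<bar>\<dots>\<bar> \<le> max_dist (ch d) (ch d')" by (rule abs_component_le_max_dist)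
    also have "\<dots> \<le> max_dist y (ch d) + max_dist y y' + max_dist y' (ch d')"
      using max_dist_triangle[of "ch d" "ch d'" y] max_dist_triangle[of y "ch d'" y']
      by (simp add: max_dist_sym[of "ch d" y])
    finally show "2 * (r / R) \<le> max_dist y y'" using y by (simp add: cube_def u_def[symmetric])
  next
    fix d y p q assume d: "d < G ^ n" and y: "y \<in> cube (ch d) (r / R)" and q: "1 \<le> q"
      and h: "r / R * real q powr \<alpha> \<le> b"
    have yu: "y \<in> cube (ch d) u" using y by (simp only: u_def)
    show "r / R \<le> max_dist y (rational_point p q)"
    proof (cases "max_dist (rational_point p q) z \<le> 2 * r")
      case True
      then have "(p, q) \<in> S" using q h by (simp add: S_def)
      moreover have "u \<le> \<sigma> i * (y $ i - z $ i)" for i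
        using offset[OF d yu, of i] u(1) by linarith
      ultimately show ?thesis using \<sigma>(2)[of u y p q] by (simp add: u_def)
    next
      case False
      have "max_dist y z \<le> r" using offset[OF d yu] by (simp add: max_dist_le_iff)
      with False have "r \<le> max_dist y (rational_point p q)"
        using max_dist_triangle[of "rational_point p q" z y]
        by (simp add: max_dist_sym[of _ y])
      moreover have "r / R \<le> r" using r R by (simp add: field_simps)
      ultimately show ?thesis by linarith
    qed
  qed
qed

(* Because of the first term of the minimum, the finitely many denominators treated before Q is
   chosen impose no condition beyond a positive gap, once Q is large. *)
definition badly_approximable_to :: "nat \<Rightarrow> nat \<Rightarrow> real ^ 'n \<Rightarrow> bool" where
  "badly_approximable_to Q q y \<longleftrightarrow>
     (\<forall>p. min (4 * real Q powr (- 1 / real n)) (\<kappa> * real q powr (- \<alpha>))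
        \<le> max_dist y (rational_point p q))"

text \<open>Only denominators treated at radius \<open>r\<close> are constrained; shrinking the cube
  brings in new ones.\<close>

definition good_cube :: "nat \<Rightarrow> real ^ 'n \<Rightarrow> real \<Rightarrow> bool" where
  "good_cube Q z r \<longleftrightarrow> (\<forall>y \<in> cube z r. \<forall>q\<ge>1. r * real q powr \<alpha> \<le> b \<longrightarrow> badly_approximable_to Q q y)"

text \<open>Denominators treated at radius \<open>r\<close> are inherited, and for the new ones
  \<open>\<kappa>\<close> fits the distance \<open>r / (2 * R)\<close>. Asking for this instead of
  \<open>r / R\<close> makes the lemma apply also to a subdivision of the concentric cube of half
  the radius.\<close>

lemma good_subcube:
  assumes good: "good_cube Q z r" and r: "0 < r" and sub: "cube z' r' \<subseteq> cube z r"
    and far: "\<And>y p q. y \<in> cube z' r' \<Longrightarrow> 1 \<le> q \<Longrightarrow> r' * real q powr \<alpha> \<le> b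
      \<Longrightarrow> r / (2 * R) \<le> max_dist y (rational_point p q)"
  shows "good_cube Q z' r'"
  unfolding good_cube_def
proof (intro ballI allI impI)
  fix y q assume y: "y \<in> cube z' r'" and q: "1 \<le> q" and h: "r' * real q powr \<alpha> \<le> b"
  show "badly_approximable_to Q q y"
  proof (cases "r * real q powr \<alpha> \<le> b")
    case True
    then show ?thesis using good y q sub unfolding good_cube_def by blast
  next
    case False
    then have "b * real q powr (- \<alpha>) \<le> r"
      using q by (simp add: powr_minus field_simps)
    then have "\<kappa> * real q powr (- \<alpha>) \<le> r / (2 * R)"
      using R by (simp add: \<kappa>_def field_simps)
    then show ?thesis unfolding badly_approximable_to_def
      using far[OF y q h] by (meson min.coboundedI2 order_trans)
  qed
qed

section \<open>Points badly approximable up to a given denominator\<close>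

lemma G_pow_pos: "0 < G ^ n" using G by simp

lemma good_cube_branches:
  assumes good: "good_cube Q z r" and r: "0 < r" and ch: "branches z r ch" and d: "d < G ^ n"
  shows "good_cube Q (ch d) (r / R)"
proof (rule good_subcube[OF good r])
  show "cube (ch d) (r / R) \<subseteq> cube z r" using ch d by (auto simp: branches_def)
  fix y p q assume "y \<in> cube (ch d) (r / R)" "1 \<le> q" "r / R * real q powr \<alpha> \<le> b"
  then have "r / R \<le> max_dist y (rational_point p q)" using ch d unfolding branches_def by blast
  moreover have "r / (2 * R) \<le> r / R" using r R by (intro divide_left_mono) auto
  ultimately show "r / (2 * R) \<le> max_dist y (rational_point p q)" by linarith
qed

text \<open>Subdividing repeatedly and keeping the first subcube brings the radius down until
  \<open>Q\<close> itself is treated; \<open>i\<close> counts the subdivisions.\<close>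

lemma badly_approximable_point:
  assumes "good_cube Q z r" "0 < r"
  obtains x where "x \<in> cube z r" "\<And>q. 1 \<le> q \<Longrightarrow> q \<le> Q \<Longrightarrow> badly_approximable_to Q q x"
proof -
  have "\<exists>x \<in> cube z r. \<forall>q. 1 \<le> q \<longrightarrow> q \<le> Q \<longrightarrow> badly_approximable_to Q q x"
    if "good_cube Q z r" "0 < r" "r * real Q powr \<alpha> \<le> b * R ^ i" for i z r
    using that
  proof (induction i arbitrary: z r)
    case 0
    have "badly_approximable_to Q q z" if "1 \<le> q" "q \<le> Q" for q
    proof -
      have "real q powr \<alpha> \<le> real Q powr \<alpha>" using that alpha by (intro powr_mono2) auto
      then have "r * real q powr \<alpha> \<le> b" using 0 mult_left_mono[of _ "real Q powr \<alpha>" r]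
        by (metis less_eq_real_def mult.right_neutral order_trans power_0)
      then show ?thesis using 0 that center_in_cube[of r z] by (auto simp: good_cube_def)
    qed
    then show ?case using 0 center_in_cube[of r z] by auto
  next
    case (Suc i)
    obtain ch where ch: "branches z r ch" using branches_exist[OF Suc.prems(2)] .
    have sub: "cube (ch 0) (r / R) \<subseteq> cube z r" using ch G_pow_pos by (auto simp: branches_def)
    have "r / R * real Q powr \<alpha> \<le> b * R ^ i" using Suc.prems(3) R by (simp add: field_simps)
    with Suc.IH[OF good_cube_branches[OF Suc.prems(1,2) ch G_pow_pos]] Suc.prems(2) R sub show ?case by auto
  qed
  moreover obtain i where "r * real Q powr \<alpha> / b < R ^ i"
    using real_arch_pow[OF R(3)] by blast
  then have "r * real Q powr \<alpha> \<le> b * R ^ i" using b by (simp add: field_simps)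
  ultimately show thesis using assms that by blast
qed

text \<open>Supplies the hypothesis \<open>bad\<close> of
  \<open>isolated_rational_approximation\<close>. After multiplication by \<open>j\<close> either
  term of the minimum suffices: the first because \<open>1 \<le> j\<close>, the second by the choice
  of \<open>\<eta>\<close>.\<close>

lemma linear_form_bound_of_badly_approximable:
  assumes bad: "badly_approximable_to Q j x" and j: "1 \<le> j" "real j < \<eta> * real Q" and Q: "1 \<le> Q"
  shows "4 * real Q powr (- 1 / real n) \<le> real j * max_dist x (rational_point v j)"
proof -
  let ?h = "real Q powr (- 1 / real n)"
  have "min (4 * ?h) (\<kappa> * real j powr (- \<alpha>)) \<le> max_dist x (rational_point v j)"
    using bad by (simp add: badly_approximable_to_def)
  then have "real j * min (4 * ?h) (\<kappa> * real j powr (- \<alpha>)) \<le> real j * max_dist x (rational_point v j)"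
    by (rule mult_left_mono) simp
  moreover have "4 * ?h \<le> real j * min (4 * ?h) (\<kappa> * real j powr (- \<alpha>))"
  proof -
    have "4 * ?h * 1 \<le> 4 * ?h * real j" using j by (intro mult_left_mono) auto
    moreover have "4 * ?h \<le> real j * (\<kappa> * real j powr (- \<alpha>))"
    proof -
      have \<eta>p: "\<eta> powr (1 / real n) \<le> \<kappa> / 4"
      proof -
        have "\<eta> powr (1 / real n) \<le> ((\<kappa> / 4) ^ n) powr (1 / real n)"
          using eta by (intro powr_mono2) auto
        also have "\<dots> = \<kappa> / 4" using kappa n_pos by (simp add: powr_realpow[symmetric] powr_powr)
        finally show ?thesis .
      qed
      have "4 * ?h = 4 * \<eta> powr (1 / real n) * (\<eta> * real Q) powr (- 1 / real n)"
        using eta Q by (simp add: powr_mult powr_minus field_simps)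
      also have "\<dots> \<le> \<kappa> * (\<eta> * real Q) powr (- 1 / real n)"
        using \<eta>p by (intro mult_right_mono) auto
      also have "\<dots> \<le> \<kappa> * real j powr (- 1 / real n)"
        using j kappa by (intro mult_left_mono powr_mono2') auto
      also have "real j powr (- 1 / real n) = real j * real j powr (- \<alpha>)"
        using powr_minus_alpha[OF j(1)] j(1) by (simp add: field_simps)
      finally show ?thesis by (simp add: mult.left_commute)
    qed
    ultimately show ?thesis by (simp add: min_def mult.commute)
  qed
  ultimately show ?thesis by linarith
qed

text \<open>The first condition makes \<open>q\<close> itself one of the denominators treated at the
  new radius \<open>\<epsilon> / 4 * \<psi> q\<close>. The second is the smallness condition of
  \<open>rational_points_on_hyperplane\<close> with base denominator \<open>q\<close>, for these
  denominators and points within \<open>3 * \<psi> q\<close>.\<close>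

definition targetable :: "real \<Rightarrow> nat \<Rightarrow> bool" where
  "targetable \<epsilon> q \<longleftrightarrow> \<psi> q * real q powr \<alpha> \<le> b \<and>
     real q ^ (n + 1) * ((b / (\<epsilon> / 4 * \<psi> q)) ^ n) ^ n * (fact (n + 1) * (3 * \<psi> q) ^ n) ^ (n + 1) < 1"

(* The new cube sits in the shell of relative width \<epsilon> around p/q, in an orthant which also keeps
   it away from all rational points that lie on a common hyperplane through p/q. *)
lemma cube_near_target:
  assumes good: "good_cube Q z r" and r: "4 * A * real Q powr (- \<alpha>) \<le> r" "r < 4 * A * R * real Q powr (- \<alpha>)"
    and \<epsilon>: "0 < \<epsilon>" "\<epsilon> \<le> 1" and Q: "1 \<le> Q"
    and small: "\<And>q. \<gamma> * real Q \<le> real q \<Longrightarrow> \<psi> q \<le> \<eta> / 2 * real Q powr (- \<alpha>)"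
    and target: "\<And>q. \<eta> * real Q \<le> real q \<Longrightarrow> targetable \<epsilon> q"
  obtains z' p q where "1 \<le> q" "q \<le> Q" "\<eta> * real Q \<le> real q"
    "\<epsilon> / 4 * \<psi> q \<le> r" "cube z' (\<epsilon> / 4 * \<psi> q) \<subseteq> cube z r"
    "\<And>y. y \<in> cube z' (\<epsilon> / 4 * \<psi> q) \<Longrightarrow> max_dist y (rational_point p q) < \<psi> q"
    "\<And>y p' q'. y \<in> cube z' (\<epsilon> / 4 * \<psi> q) \<Longrightarrow> 1 \<le> q' \<Longrightarrow> b < r * real q' powr \<alpha>
      \<Longrightarrow> \<epsilon> / 4 * \<psi> q * real q' powr \<alpha> \<le> b
      \<Longrightarrow> (1 - \<epsilon>) * \<psi> q' \<le> max_dist y (rational_point p' q')"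
proof -
  have "0 < 4 * A * real Q powr (- \<alpha>)" using A Q by simp
  then have r0: "0 < r" using r(1) by linarith
  define r1 where "r1 = r / 2 / R"
  \<comment> \<open>Halving the cube leaves room: \<open>x\<close> is within \<open>r / 2\<close> of
    \<open>z\<close>, p/q within \<open>r / 4\<close> of \<open>x\<close>, and the new cube within
    \<open>\<psi> q \<le> r / 4\<close> of p/q.\<close>
  obtain ch where ch: "branches z (r / 2) ch" using branches_exist[of "r / 2" z] r0 by auto
  define z1 where "z1 = ch 0"
  have r1: "0 < r1" using r0 R by (simp add: r1_def)
  have sub1: "cube z1 r1 \<subseteq> cube z (r / 2)"
    using ch G_pow_pos by (auto simp: branches_def z1_def r1_def)
  have "good_cube Q z1 r1"
  proof (rule good_subcube[OF good r0])
    show "cube z1 r1 \<subseteq> cube z r" using sub1 cube_mono[of "r / 2" r z] r0 by auto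
    fix y p q assume "y \<in> cube z1 r1" "1 \<le> q" "r1 * real q powr \<alpha> \<le> b"
    then show "r / (2 * R) \<le> max_dist y (rational_point p q)"
      using ch G_pow_pos unfolding branches_def z1_def r1_def by (metis divide_divide_eq_left)
  qed
  then obtain x where x: "x \<in> cube z1 r1" "\<And>q. 1 \<le> q \<Longrightarrow> q \<le> Q \<Longrightarrow> badly_approximable_to Q q x"
    using badly_approximable_point r1 by blast
  have xz: "max_dist x z \<le> r / 2" using x(1) sub1 by (auto simp: cube_def)
  let ?h = "real Q powr (- 1 / real n)"
  have bad: "4 * ?h \<le> real j * max_dist x (rational_point v j)"
    if "1 \<le> j" "real j < \<eta> * real Q" for v j
  proof -
    have "\<eta> * real Q \<le> 1 * real Q" using eta by (intro mult_right_mono) auto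
    then have "j \<le> Q" using that by linarith
    then show ?thesis using linear_form_bound_of_badly_approximable x(2) that Q by blast
  qed
  obtain p q where q: "1 \<le> q" "q \<le> Q" "\<eta> * real Q \<le> real q"
    and px: "max_dist x (rational_point p q) \<le> (2 / \<eta> + 1) * ?h / real Q"
    and reduced: "\<And>p' q'. 1 \<le> q' \<Longrightarrow> rational_point p' q' = rational_point p q \<Longrightarrow> q \<le> q'"
    and isolated: "\<And>p' q'. 1 \<le> q' \<Longrightarrow> q' \<le> q \<Longrightarrow> rational_point p' q' \<noteq> rational_point p q
      \<Longrightarrow> \<eta> * ?h / real Q \<le> max_dist (rational_point p q) (rational_point p' q')"
    using isolated_approximation[OF Q eta(1,2) refl bad] by metis
  define c where "c = rational_point p q"
  let ?Qa = "real Q powr (- \<alpha>)"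
  have Qa: "0 < ?Qa" using Q by simp
  have hQ: "u * ?h / real Q = u * ?Qa" for u
    using powr_minus_alpha[OF Q] by (metis times_divide_eq_right)
  have xc: "max_dist x c \<le> r / 4"
    using px r(1) unfolding hQ c_def A_def by linarith
  have psiq: "0 < \<psi> q" using psi_pos q by simp
  have "\<gamma> * real Q \<le> \<eta> * real Q" using gamma by (intro mult_right_mono) auto
  then have psiqQ: "\<psi> q \<le> \<eta> / 2 * ?Qa" using q(3) by (intro small) linarith
  have "\<eta> / 2 * ?Qa \<le> A * ?Qa" using eta A Qa by (intro mult_right_mono) linarith+
  then have psiqr: "\<psi> q \<le> r / 4" using psiqQ r(1) by linarith
  define r' where "r' = \<epsilon> / 4 * \<psi> q"
  have r': "0 < r'" "r' \<le> \<psi> q / 4"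
    using \<epsilon> psiq mult_right_mono[of "\<epsilon> / 4" "1 / 4" "\<psi> q"] by (auto simp: r'_def)
  have tq: "\<psi> q * real q powr \<alpha> \<le> b"
    "real q ^ (n + 1) * ((b / r') ^ n) ^ n * (fact (n + 1) * (3 * \<psi> q) ^ n) ^ (n + 1) < 1"
    using target[OF q(3)] by (auto simp: targetable_def r'_def)
  define S where "S = {(p' :: int ^ 'n, q'). 1 \<le> q' \<and> r' * real q' powr \<alpha> \<le> b
    \<and> max_dist (rational_point p' q') c \<le> 3 * \<psi> q}"
  have S: "1 \<le> q' \<and> real q' ^ (n + 1) \<le> (b / r') ^ n \<and> max_dist (rational_point p' q') c \<le> 3 * \<psi> q"
    if "(p', q') \<in> S" for p' q'
    using that power_le_of_height[of q' r' b] r' by (auto simp: S_def)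
  have "r' * real q powr \<alpha> \<le> \<psi> q * real q powr \<alpha>" using r' psiq by (intro mult_right_mono) auto
  then have "r' * real q powr \<alpha> \<le> b" using tq(1) by linarith
  then have "(p, q) \<in> S" using q psiq by (simp add: S_def c_def)
  then have base: "\<exists>p0 q0. (p0, q0) \<in> S \<and> real q0 ^ (n + 1) * ((b / r') ^ n) ^ n
      * (fact (n + 1) * (3 * \<psi> q) ^ n) ^ (n + 1) < 1"
    using tq(2) by blast
  have psi3: "0 \<le> 3 * \<psi> q" using psiq by simp
  obtain \<sigma> :: "'n \<Rightarrow> real" where \<sigma>: "\<And>i. \<sigma> i = 1 \<or> \<sigma> i = - 1"
    "\<And>y t p' q'. (\<And>i. t \<le> \<sigma> i * (y $ i - c $ i)) \<Longrightarrow> (p', q') \<in> S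
        \<Longrightarrow> t \<le> max_dist y (rational_point p' q')"
    using avoid_orthant[OF S base psi3] by metis
  define w where "w = \<epsilon> * \<psi> q"
  have w: "0 < w" "w \<le> \<psi> q" "r' = w / 4" "(1 - \<epsilon>) * \<psi> q = \<psi> q - w"
    using \<epsilon> psiq mult_right_mono[of \<epsilon> 1 "\<psi> q"] by (auto simp: w_def r'_def left_diff_distrib)
  \<comment> \<open>In every coordinate the new cube stays between
    \<open>\<psi> q - 3 * w / 4\<close> and \<open>\<psi> q - w / 4\<close> away from
    \<open>c\<close>, on the side given by \<open>\<sigma>\<close>. So it is strictly within
    \<open>\<psi> q\<close>, while the lower bound holds in all coordinates at once, as the orthant
    property requires.\<close>
  define z' where "z' = (\<chi> i. c $ i + \<sigma> i * (\<psi> q - w / 2))"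
  have offset: "(1 - \<epsilon>) * \<psi> q \<le> \<sigma> i * (y $ i - c $ i) \<and> \<bar>y $ i - c $ i\<bar> \<le> \<psi> q - w / 4"
    if "y \<in> cube z' r'" for y i
  proof -
    have "\<bar>y $ i - z' $ i\<bar> \<le> r'" using that by (simp add: cube_def max_dist_le_iff)
    then have "\<bar>(y $ i - c $ i) - \<sigma> i * (\<psi> q - w / 2)\<bar> \<le> w / 4" by (simp add: z'_def w(3) algebra_simps)
    then have le: "(y $ i - c $ i) - \<sigma> i * (\<psi> q - w / 2) \<le> w / 4"
      "\<sigma> i * (\<psi> q - w / 2) - (y $ i - c $ i) \<le> w / 4" by linarith+
    from \<sigma>(1)[of i] show ?thesis
    proof
      assume "\<sigma> i = 1"
      with le w(1,2) show ?thesis unfolding w(4) by (auto simp: abs_le_iff)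
    next
      assume "\<sigma> i = - 1"
      with le w(1,2) show ?thesis unfolding w(4) by (auto simp: abs_le_iff)
    qed
  qed
  have yc: "max_dist y c \<le> \<psi> q - w / 4" if "y \<in> cube z' r'" for y
    using offset[OF that] by (simp add: max_dist_le_iff)
  show thesis
  proof (rule that[OF q, of z' p, folded r'_def c_def])
    show "r' \<le> r" using r' psiq psiqr r0 by linarith
    show "cube z' r' \<subseteq> cube z r"
    proof
      fix y assume "y \<in> cube z' r'"
      then have "max_dist y c \<le> \<psi> q - w / 4" by (rule yc)
      then have "max_dist y z \<le> r"
        using max_dist_triangle[of y z c] max_dist_triangle[of c z x] xz xc psiqr w(1)
        by (simp add: max_dist_sym[of c x])
      then show "y \<in> cube z r" by (simp add: cube_def)
    qed
    show "max_dist y c < \<psi> q" if "y \<in> cube z' r'" for y using yc[OF that] w(1) by simp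
    fix y p' q' assume y: "y \<in> cube z' r'" and q': "1 \<le> q'" "b < r * real q' powr \<alpha>"
      "r' * real q' powr \<alpha> \<le> b"
    let ?d = "max_dist y (rational_point p' q')"
    have psi': "(1 - \<epsilon>) * \<psi> q' \<le> \<psi> q'"
      using \<epsilon> psi_pos[OF q'(1)] mult_right_mono[of "1 - \<epsilon>" 1 "\<psi> q'"] by auto
    show "(1 - \<epsilon>) * \<psi> q' \<le> ?d"
    \<comment> \<open>For denominators from \<open>q\<close> on, points within
      \<open>3 * \<psi> q\<close> of \<open>c\<close> are handled by the orthant and the others by
      the triangle inequality. For smaller ones \<open>c\<close> is isolated: the gap
      \<open>\<eta> * real Q powr (- \<alpha>)\<close> is at least
      \<open>\<psi> q + \<psi> q'\<close>.\<close>
    proof (cases "q \<le> q'")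
      case True
      then have le: "\<psi> q' \<le> \<psi> q" using psi_antimono q by simp
      show ?thesis
      proof (cases "max_dist (rational_point p' q') c \<le> 3 * \<psi> q")
        case True
        then have "(p', q') \<in> S" using q' by (simp add: S_def)
        then have "(1 - \<epsilon>) * \<psi> q \<le> ?d" using \<sigma>(2) offset[OF y] by blast
        moreover have "(1 - \<epsilon>) * \<psi> q' \<le> (1 - \<epsilon>) * \<psi> q" using le \<epsilon> by (intro mult_left_mono) auto
        ultimately show ?thesis by linarith
      next
        case False
        then show ?thesis
          using max_dist_triangle[of "rational_point p' q'" c y] yc[OF y] w(1) le psi' psiq
          by (simp add: max_dist_sym[of "rational_point p' q'" y])
      qed
    next
      case False
      have "rational_point p' q' \<noteq> c" using reduced[OF q'(1), of p'] False by (auto simp: c_def)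
      then have iso: "\<eta> * ?Qa \<le> max_dist c (rational_point p' q')"
        using isolated[OF q'(1), of p'] False unfolding hQ c_def by simp
      have "\<gamma> * real Q \<le> real q'"
      proof (rule ccontr)
        assume "\<not> ?thesis"
        then have "real q' powr \<alpha> \<le> (\<gamma> * real Q) powr \<alpha>" using alpha by (intro powr_mono2) auto
        also have "\<dots> = \<gamma> powr \<alpha> * real Q powr \<alpha>" using gamma by (simp add: powr_mult)
        also have "\<dots> \<le> b / (4 * A * R) * real Q powr \<alpha>" using gamma by (intro mult_right_mono) auto
        finally have "r * real q' powr \<alpha> \<le> r * (b / (4 * A * R) * real Q powr \<alpha>)"
          using r0 by (intro mult_left_mono) auto
        also have "\<dots> \<le> (4 * A * R * ?Qa) * (b / (4 * A * R) * real Q powr \<alpha>)"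
          using r(2) b A R by (intro mult_right_mono) auto
        also have "\<dots> = b" using A R Q by (simp add: powr_minus)
        finally show False using q'(2) by simp
      qed
      then have "\<psi> q' \<le> \<eta> / 2 * ?Qa" by (rule small)
      moreover have "max_dist c (rational_point p' q') \<le> max_dist y c + ?d"
        using max_dist_triangle[of c "rational_point p' q'" y] by (simp add: max_dist_sym[of c y])
      ultimately show ?thesis using iso psiqQ yc[OF y] w(1) psi' by linarith
    qed
  qed
qed

text \<open>Tends to 0, as exactness requires; the offset 2 keeps \<open>1 - eps k\<close> positive
  also for \<open>k = 0\<close>, so that the gap \<open>g\<close> in \<open>child_exists\<close> is
  positive.\<close>

definition "eps k = 1 / (real k + 2)"

lemma eps: "0 < eps k" "eps k \<le> 1" by (auto simp: eps_def)

section \<open>Choosing the next scale to aim at\<close>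

lemma psi_small_alpha: "0 < \<nu> \<Longrightarrow> \<forall>\<^sub>F q in sequentially. \<psi> q \<le> \<nu> * real q powr (- \<alpha>)"
  using psi_small by (simp add: \<alpha>_def)

text \<open>The powers of \<open>\<psi> q\<close> in the determinant condition cancel up to one
  factor \<open>\<psi> q ^ n\<close>, leaving a constant times the n-th power of
  \<open>\<psi> q * real q powr \<alpha>\<close>, which tends to 0.\<close>

lemma eventually_targetable:
  assumes \<epsilon>: "0 < \<epsilon>"
  shows "\<forall>\<^sub>F q in sequentially. targetable \<epsilon> q"
proof -
  define K where "K = ((b / (\<epsilon> / 4)) ^ n) ^ n * (fact (n + 1) * 3 ^ n) ^ (n + 1)"
  have K: "0 < K" using b \<epsilon> by (simp add: K_def)
  define \<nu> where "\<nu> = min b (min 1 (1 / (2 * K)))"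
  have \<nu>: "0 < \<nu>" "\<nu> \<le> b" "\<nu> \<le> 1" "\<nu> \<le> 1 / (2 * K)" using b K by (auto simp: \<nu>_def)
  show ?thesis using psi_small_alpha[OF \<nu>(1)] eventually_ge_at_top[of 1]
  proof eventually_elim
    case (elim q)
    have psi: "0 < \<psi> q" using psi_pos elim by simp
    have x: "\<psi> q * real q powr \<alpha> \<le> \<nu>"
      using elim by (simp add: powr_minus field_simps)
    have "(\<psi> q * real q powr \<alpha>) ^ n \<le> \<nu> ^ n" using x psi by (intro power_mono) auto
    also have "\<dots> \<le> \<nu> ^ 1" using \<nu> n_pos by (intro power_decreasing) auto
    finally have y: "real q ^ (n + 1) * \<psi> q ^ n \<le> \<nu>"
      using powr_alpha_power[OF elim(2)] by (simp add: power_mult_distrib mult.commute)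
    have "real q ^ (n + 1) * ((b / (\<epsilon> / 4 * \<psi> q)) ^ n) ^ n * (fact (n + 1) * (3 * \<psi> q) ^ n) ^ (n + 1)
        = real q ^ (n + 1) * (((b / (\<epsilon> / 4)) ^ n) ^ n / (\<psi> q ^ n) ^ n)
          * ((fact (n + 1) * 3 ^ n) ^ (n + 1) * ((\<psi> q ^ n) ^ n * \<psi> q ^ n))"
    proof -
      have e1: "((b / (\<epsilon> / 4 * \<psi> q)) ^ n) ^ n = ((b / (\<epsilon> / 4)) ^ n) ^ n / (\<psi> q ^ n) ^ n"
        by (simp only: divide_divide_eq_left[symmetric] power_divide)
      have e2: "(fact (n + 1) * (3 * \<psi> q) ^ n) ^ (n + 1)
          = (fact (n + 1) * 3 ^ n) ^ (n + 1) * ((\<psi> q ^ n) ^ n * \<psi> q ^ n)"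
        by (simp only: power_mult_distrib power_add power_one_right ac_simps)
      show ?thesis by (simp only: e1 e2)
    qed
    also have "\<dots> = K * (real q ^ (n + 1) * \<psi> q ^ n)"
      using psi by (simp add: K_def)
    also have "\<dots> \<le> K * (1 / (2 * K))" using y \<nu> K by (intro mult_left_mono) linarith+
    also have "\<dots> < 1" using K by simp
    finally show ?case using x \<nu> by (simp add: targetable_def)
  qed
qed

text \<open>The condition \<open>real k + 1 \<le> \<eta> * real Q\<close> makes the denominators of
  successive approximations unbounded.\<close>

definition target :: "nat \<Rightarrow> nat \<Rightarrow> bool" where
  "target k Q \<longleftrightarrow> 1 \<le> Q \<and> real Q powr (- \<tau>) \<le> \<psi> Q \<and> real k + 1 \<le> \<eta> * real Q \<and>
     (\<forall>q. \<gamma> * real Q \<le> real q \<longrightarrow> \<psi> q \<le> \<eta> / 2 * real Q powr (- \<alpha>)) \<and>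
     (\<forall>q. \<eta> * real Q \<le> real q \<longrightarrow> targetable (eps k) q)"

text \<open>Every requirement holds for all large \<open>Q\<close>, except
  \<open>real Q powr (- \<tau>) \<le> \<psi> Q\<close>, which holds for infinitely many; so some
  \<open>Q\<close> meets them all. The mass requirement holds eventually because
  \<open>exponents\<close> is strict and beats the constants.\<close>

lemma target_exists:
  assumes r: "0 < r" and g: "0 < g"
  obtains Q where "target k Q" "4 * real Q powr (- 1 / real n) \<le> g"
    "4 * A * R * real Q powr (- \<alpha>) \<le> r"
    "(4 * A * R * real Q powr (- \<alpha>) / r) powr s' \<le> (eps k / 4 * real Q powr (- \<tau>)) powr s"
proof -
  have ev_k: "\<forall>\<^sub>F Q in sequentially. real k + 1 \<le> \<eta> * real Q"
  proof -
    have "\<forall>\<^sub>F Q in sequentially. (real k + 1) / \<eta> \<le> real Q"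
      by (rule filterlim_real_sequentially[unfolded filterlim_at_top, rule_format])
    then show ?thesis by eventually_elim (use eta in \<open>simp add: field_simps\<close>)
  qed
  have ev_small: "\<forall>\<^sub>F Q in sequentially. 1 \<le> Q \<longrightarrow>
      (\<forall>q. \<gamma> * real Q \<le> real q \<longrightarrow> \<psi> q \<le> \<eta> / 2 * real Q powr (- \<alpha>))"
  proof -
    have "0 < \<eta> / 2 * \<gamma> powr \<alpha>" using eta gamma by simp
    from eventually_all_ge_scaled[OF psi_small_alpha[OF this] gamma(1)]
    show ?thesis
    proof eventually_elim
      case (elim Q)
      show ?case
      proof (intro impI allI)
        fix q assume Q: "1 \<le> Q" and q: "\<gamma> * real Q \<le> real q"
        have "\<psi> q \<le> \<eta> / 2 * \<gamma> powr \<alpha> * real q powr (- \<alpha>)" using elim q by simp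
        also have "\<dots> \<le> \<eta> / 2 * \<gamma> powr \<alpha> * (\<gamma> * real Q) powr (- \<alpha>)"
          using q Q eta gamma alpha by (intro mult_left_mono powr_mono2') auto
        also have "\<dots> = \<eta> / 2 * real Q powr (- \<alpha>)"
          using gamma Q by (simp add: powr_mult powr_minus field_simps)
        finally show "\<psi> q \<le> \<eta> / 2 * real Q powr (- \<alpha>)" .
      qed
    qed
  qed
  have ev_mass: "\<forall>\<^sub>F Q in sequentially.
      (4 * A * R * real Q powr (- \<alpha>) / r) powr s' \<le> (eps k / 4 * real Q powr (- \<tau>)) powr s"
  proof -
    have "\<tau> * s - \<alpha> * s' < 0" using exponents by (simp add: \<alpha>_def)
    moreover have "0 < (eps k / 4) powr s / (4 * A * R / r) powr s'"
      using eps[of k] A R r by simp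
    ultimately have "\<forall>\<^sub>F Q in sequentially. real Q powr (\<tau> * s - \<alpha> * s')
        \<le> (eps k / 4) powr s / (4 * A * R / r) powr s'" by (rule eventually_powr_le)
    then show ?thesis
    proof eventually_elim
      case (elim Q)
      have "(4 * A * R * real Q powr (- \<alpha>) / r) powr s'
          = (4 * A * R / r) powr s' * real Q powr (- \<alpha> * s')"
      proof -
        have "4 * A * R * real Q powr (- \<alpha>) / r = (4 * A * R / r) * real Q powr (- \<alpha>)" by simp
        then show ?thesis by (simp only: powr_mult powr_powr)
      qed
      also have "real Q powr (- \<alpha> * s') = real Q powr (\<tau> * s - \<alpha> * s') * real Q powr (- \<tau> * s)"
        by (simp add: powr_add[symmetric])
      also have "(4 * A * R / r) powr s' * \<dots> =
          ((4 * A * R / r) powr s' * real Q powr (\<tau> * s - \<alpha> * s')) * real Q powr (- \<tau> * s)" by simp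
      also have "\<dots> \<le> (eps k / 4) powr s * real Q powr (- \<tau> * s)"
        using elim A R r by (intro mult_right_mono) (auto simp: field_simps)
      also have "\<dots> = (eps k / 4 * real Q powr (- \<tau>)) powr s"
        by (simp only: powr_mult powr_powr)
      finally show ?case .
    qed
  qed
  have ev_g: "\<forall>\<^sub>F Q in sequentially. real Q powr (- 1 / real n) \<le> g / 4"
    using g n_pos by (intro eventually_powr_le) auto
  have ev_r: "\<forall>\<^sub>F Q in sequentially. real Q powr (- \<alpha>) \<le> r / (4 * A * R)"
    using r A R alpha by (intro eventually_powr_le) auto
  have "\<exists>\<^sub>F Q in sequentially. real Q powr (- \<tau>) \<le> \<psi> Q \<and> 1 \<le> Q \<and> real k + 1 \<le> \<eta> * real Q \<and>
     (\<forall>q. \<gamma> * real Q \<le> real q \<longrightarrow> \<psi> q \<le> \<eta> / 2 * real Q powr (- \<alpha>)) \<and>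
     (\<forall>q. \<eta> * real Q \<le> real q \<longrightarrow> targetable (eps k) q) \<and>
     (4 * A * R * real Q powr (- \<alpha>) / r) powr s' \<le> (eps k / 4 * real Q powr (- \<tau>)) powr s \<and>
     real Q powr (- 1 / real n) \<le> g / 4 \<and> real Q powr (- \<alpha>) \<le> r / (4 * A * R)"
    by (rule frequently_mp[OF _ psi_large])
      (use ev_k ev_small ev_mass ev_g ev_r eventually_ge_at_top[of 1]
        eventually_all_ge_scaled[OF eventually_targetable[OF eps(1)[of k]] eta(1)] in
        \<open>eventually_elim, simp\<close>)
  then obtain Q where Q: "real Q powr (- \<tau>) \<le> \<psi> Q" "1 \<le> Q" "real k + 1 \<le> \<eta> * real Q"
     "\<forall>q. \<gamma> * real Q \<le> real q \<longrightarrow> \<psi> q \<le> \<eta> / 2 * real Q powr (- \<alpha>)"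
     "\<forall>q. \<eta> * real Q \<le> real q \<longrightarrow> targetable (eps k) q"
     "(4 * A * R * real Q powr (- \<alpha>) / r) powr s' \<le> (eps k / 4 * real Q powr (- \<tau>)) powr s"
     "real Q powr (- 1 / real n) \<le> g / 4" "real Q powr (- \<alpha>) \<le> r / (4 * A * R)"
    by (blast dest: frequently_ex)
  show thesis
  proof (rule that)
    show "target k Q" using Q by (simp add: target_def)
    show "4 * real Q powr (- 1 / real n) \<le> g" using Q(7) by simp
    show "4 * A * R * real Q powr (- \<alpha>) \<le> r" using Q(8) A R by (simp add: field_simps)
  qed (fact Q(6))
qed

(* The third condition reserves the mass bound for the moment when the radius has come down to
   about Q powr (- \<alpha>), Q = goal v, and the cube shrinks to radius eps k / 4 * \<psi> q. *)
definition node_inv :: "nat \<Rightarrow> 'n node \<Rightarrow> bool" where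
  "node_inv m v \<longleftrightarrow> 0 < radius v \<and> 1 / (real G ^ n) ^ m \<le> radius v powr s \<and>
     1 / (real G ^ n) ^ m * (4 * A * R * real (goal v) powr (- \<alpha>) / radius v) powr s'
       \<le> (eps (stage v) / 4 * real (goal v) powr (- \<tau>)) powr s \<and>
     4 * A * R * real (goal v) powr (- \<alpha>) \<le> radius v \<and>
     target (stage v) (goal v) \<and> good_cube (goal v) (center v) (radius v)"

text \<open>The avoidance clause concerns exactly the denominators that become treated on passing
  from \<open>v\<close> to \<open>w\<close>; its premise on \<open>\<psi> q\<close> holds for all
  large \<open>q\<close>. A rise of the stage certifies an approximation shared by all points of the
  new cube.\<close>

definition refines :: "'n node \<Rightarrow> 'n node \<Rightarrow> bool" where
  "refines v w \<longleftrightarrow> node_cube w \<subseteq> node_cube v \<and> radius w \<le> radius v / R \<and>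
     (\<forall>y\<in>node_cube w. \<forall>p. \<forall>q\<ge>1. \<psi> q \<le> \<kappa> * real q powr (- \<alpha>) \<longrightarrow> b < radius v * real q powr \<alpha> \<longrightarrow>
        radius w * real q powr \<alpha> \<le> b \<longrightarrow> (1 - eps (stage v)) * \<psi> q \<le> max_dist y (rational_point p q)) \<and>
     (stage w = stage v \<and> goal w = goal v \<or>
      stage w = Suc (stage v) \<and>
        (\<exists>p q. stage v + 1 \<le> q \<and> (\<forall>y\<in>node_cube w. max_dist y (rational_point p q) < \<psi> q)))"

section \<open>Nodes and their children\<close>

lemma R_powr_le: "R powr s' \<le> real G ^ n" "R powr s \<le> real G ^ n"
proof -
  show *: "R powr s' \<le> real G ^ n" using branching by (simp add: R_def)
  have "R powr s \<le> R powr s'" using R s by (intro powr_mono) auto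
  with * show "R powr s \<le> real G ^ n" by linarith
qed

lemma root_exists:
  obtains v where "node_inv 0 v"
proof -
  \<comment> \<open>A cube of radius \<open>1 + b\<close> treats no denominator
    \<open>q \<ge> 1\<close>, so the root is good vacuously.\<close>
  have "0 < 1 + b" using b by simp
  then obtain Q where Q: "target 0 Q" "4 * A * R * real Q powr (- \<alpha>) \<le> 1 + b"
    "(4 * A * R * real Q powr (- \<alpha>) / (1 + b)) powr s' \<le> (eps 0 / 4 * real Q powr (- \<tau>)) powr s"
    using target_exists[of "1 + b" 1 0] by (metis zero_less_one)
  have "good_cube Q z0 (1 + b)"
    unfolding good_cube_def
  proof (intro ballI allI impI)
    fix y q assume q: "1 \<le> q" "(1 + b) * real q powr \<alpha> \<le> b"
    have "1 \<le> real q powr \<alpha>" using q alpha by (simp add: ge_one_powr_ge_zero)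
    then have "(1 + b) * 1 \<le> (1 + b) * real q powr \<alpha>" using b by (intro mult_left_mono) auto
    then show "badly_approximable_to Q q y" using q by simp
  qed
  moreover have "1 \<le> (1 + b) powr s" using b s by (simp add: ge_one_powr_ge_zero)
  ultimately have "node_inv 0 (Node z0 (1 + b) 0 Q)"
    using Q b by (simp add: node_inv_def)
  then show thesis by (rule that)
qed

lemma avoid_of_branches:
  assumes ch: "branches z r ch" and d: "d < G ^ n" and r: "0 < r" and y: "y \<in> cube (ch d) (r / R)"
    and q: "1 \<le> q" "\<psi> q \<le> \<kappa> * real q powr (- \<alpha>)" "b < r * real q powr \<alpha>" "r / R * real q powr \<alpha> \<le> b"
  shows "(1 - eps k) * \<psi> q \<le> max_dist y (rational_point p q)"
proof -
  have "(1 - eps k) * \<psi> q \<le> \<psi> q" using eps[of k] psi_pos[OF q(1)] by (simp add: mult_le_cancel_right1)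
  also have "\<dots> \<le> \<kappa> * real q powr (- \<alpha>)" by (rule q(2))
  also have "\<dots> \<le> r / R"
  proof -
    have "b * real q powr (- \<alpha>) \<le> r" using q(1,3) by (simp add: powr_minus field_simps)
    then have "b * real q powr (- \<alpha>) / (2 * R) \<le> r / (2 * R)" using R by (intro divide_right_mono) auto
    also have "\<dots> \<le> r / R" using r R by (intro divide_left_mono) auto
    finally show ?thesis by (simp add: \<kappa>_def)
  qed
  also have "\<dots> \<le> max_dist y (rational_point p q)" using ch d y q unfolding branches_def by blast
  finally show ?thesis .
qed

text \<open>The subcube itself is the child while its radius stays above the scale of the goal. Once
  below, it is replaced by the cube near a rational point from \<open>cube_near_target\<close>, and
  a new goal is set.\<close>

lemma child_exists:
  assumes inv: "node_inv m v" and ch: "branches (center v) (radius v) ch" and d: "d < G ^ n"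
  obtains w where "node_inv (Suc m) w" "refines v w" "node_cube w \<subseteq> cube (ch d) (radius v / R)"
proof -
  obtain z r k Q where v: "v = Node z r k Q" by (cases v)
  have r: "0 < r" and mass1: "1 / (real G ^ n) ^ m \<le> r powr s"
    and mass2: "1 / (real G ^ n) ^ m * (4 * A * R * real Q powr (- \<alpha>) / r) powr s'
      \<le> (eps k / 4 * real Q powr (- \<tau>)) powr s"
    and rQ: "4 * A * R * real Q powr (- \<alpha>) \<le> r" and tgt: "target k Q" and good: "good_cube Q z r"
    using inv by (auto simp: v node_inv_def)
  note ch' = ch[unfolded v node.sel]
  have Q: "1 \<le> Q" using tgt by (simp add: target_def)
  have Qa: "0 < 4 * A * R * real Q powr (- \<alpha>)" using A R Q by simp
  define N where "N = real G ^ n"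
  have N: "0 < N" using G by (simp add: N_def)
  define r1 where "r1 = r / R"
  have r1: "0 < r1" "r = R * r1" using r R by (auto simp: r1_def)
  have sub: "cube (ch d) r1 \<subseteq> cube z r" using ch' d by (auto simp: branches_def r1_def)
  have good1: "good_cube Q (ch d) r1" unfolding r1_def by (rule good_cube_branches[OF good r ch' d])
  have mass1': "1 / N ^ Suc m \<le> r1 powr s"
  proof -
    have "1 / N ^ Suc m = 1 / N ^ m / N" by simp
    also have "\<dots> \<le> r powr s / N" using mass1 N by (intro divide_right_mono) (auto simp: N_def)
    also have "\<dots> \<le> r powr s / R powr s" using R_powr_le(2) R N by (intro divide_left_mono) (auto simp: N_def)
    also have "\<dots> = r1 powr s" using r R by (simp add: r1_def powr_divide)
    finally show ?thesis .
  qed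
  have mass2': "1 / N ^ Suc m * (4 * A * R * real Q powr (- \<alpha>) / r1) powr s'
      \<le> (eps k / 4 * real Q powr (- \<tau>)) powr s"
  proof -
    let ?x = "4 * A * R * real Q powr (- \<alpha>) / r"
    have "4 * A * R * real Q powr (- \<alpha>) / r1 = ?x * R" by (simp add: r1_def)
    then have "1 / N ^ Suc m * (4 * A * R * real Q powr (- \<alpha>) / r1) powr s'
        = 1 / N ^ m * (?x * R) powr s' / N" by simp
    also have "(?x * R) powr s' = ?x powr s' * R powr s'" by (rule powr_mult)
    also have "1 / N ^ m * (?x powr s' * R powr s') / N = (1 / N ^ m * ?x powr s') * (R powr s' / N)" by simp
    also have "\<dots> \<le> (1 / N ^ m * ?x powr s') * 1"
      using R_powr_le(1) N by (intro mult_left_mono) (auto simp: N_def)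
    finally show ?thesis using mass2 by (simp add: N_def)
  qed
  show thesis
  proof (cases "4 * A * R * real Q powr (- \<alpha>) \<le> r1")
    case True
    let ?w = "Node (ch d) r1 k Q"
    have "node_inv (Suc m) ?w"
      using r1 mass1' mass2' True tgt good1 by (simp add: node_inv_def N_def)
    moreover have "refines v ?w"
      using sub avoid_of_branches[OF ch' d r] by (auto simp: refines_def v r1_def)
    ultimately show thesis by (rule that) (simp add: v r1_def)
  next
    case False
    have r1Q: "4 * A * real Q powr (- \<alpha>) \<le> r1" using rQ R unfolding r1(2) by (simp add: mult.commute mult.left_commute)
    obtain z' p q where q: "1 \<le> q" "q \<le> Q" "\<eta> * real Q \<le> real q"
      and r': "eps k / 4 * \<psi> q \<le> r1" and sub': "cube z' (eps k / 4 * \<psi> q) \<subseteq> cube (ch d) r1"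
      and close: "\<And>y. y \<in> cube z' (eps k / 4 * \<psi> q) \<Longrightarrow> max_dist y (rational_point p q) < \<psi> q"
      and far: "\<And>y p' q'. y \<in> cube z' (eps k / 4 * \<psi> q) \<Longrightarrow> 1 \<le> q' \<Longrightarrow> b < r1 * real q' powr \<alpha>
        \<Longrightarrow> eps k / 4 * \<psi> q * real q' powr \<alpha> \<le> b
        \<Longrightarrow> (1 - eps k) * \<psi> q' \<le> max_dist y (rational_point p' q')"
    proof (rule cube_near_target[OF good1 r1Q _ eps[of k] Q])
      show "r1 < 4 * A * R * real Q powr (- \<alpha>)" using False by simp
    qed (use tgt in \<open>auto simp: target_def\<close>)
    define r' where "r' = eps k / 4 * \<psi> q"
    note r' = r'[folded r'_def] and sub' = sub'[folded r'_def] and close = close[folded r'_def]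
      and far = far[folded r'_def]
    have r'0: "0 < r'" using eps[of k] psi_pos[OF q(1)] by (simp add: r'_def)
    \<comment> \<open>\<open>M\<close> bounds the denominators treated in the new cube, so they
      share a positive gap \<open>g\<close>. The new goal \<open>Q'\<close> is chosen afterwards, so
      large that the first term of the minimum in \<open>badly_approximable_to\<close> is at most
      \<open>g\<close>.\<close>
    define M where "M = Suc (nat \<lceil>(b / r') powr (1 / \<alpha>)\<rceil>)"
    have M: "q' \<le> M" if "1 \<le> q'" "r' * real q' powr \<alpha> \<le> b" for q'
    proof -
      have "real q' powr \<alpha> \<le> b / r'" using that r'0 by (simp add: field_simps)
      then have "(real q' powr \<alpha>) powr (1 / \<alpha>) \<le> (b / r') powr (1 / \<alpha>)"
        using alpha by (intro powr_mono2) auto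
      then have "real q' \<le> (b / r') powr (1 / \<alpha>)" using alpha that by (simp add: powr_powr)
      then show ?thesis unfolding M_def by linarith
    qed
    define g where "g = min (min (4 * real Q powr (- 1 / real n)) (\<kappa> * real M powr (- \<alpha>))) ((1 - eps k) * \<psi> M)"
    have eps1: "0 < 1 - eps k" by (simp add: eps_def field_simps)
    have "1 \<le> M" by (simp add: M_def)
    then have g: "0 < g" using Q kappa eps1 psi_pos[of M] by (simp add: g_def)
    have gap: "g \<le> max_dist y (rational_point p' q')"
      if y: "y \<in> cube z' r'" and q': "1 \<le> q'" "r' * real q' powr \<alpha> \<le> b" for y p' q'
    proof (cases "r1 * real q' powr \<alpha> \<le> b")
      case True
      then have bad: "badly_approximable_to Q q' y"
        using good1 y sub' q' unfolding good_cube_def by blast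
      have "real M powr (- \<alpha>) \<le> real q' powr (- \<alpha>)"
        using M[OF q'] q' alpha by (intro powr_mono2') auto
      then have "\<kappa> * real M powr (- \<alpha>) \<le> \<kappa> * real q' powr (- \<alpha>)" using kappa by simp
      then have "g \<le> min (4 * real Q powr (- 1 / real n)) (\<kappa> * real q' powr (- \<alpha>))"
        by (auto simp: g_def)
      also have "\<dots> \<le> max_dist y (rational_point p' q')"
        using bad by (simp add: badly_approximable_to_def)
      finally show ?thesis .
    next
      case False
      have "g \<le> (1 - eps k) * \<psi> M" by (simp add: g_def)
      also have "\<dots> \<le> (1 - eps k) * \<psi> q'"
        using eps1 psi_antimono[OF q'(1) M[OF q']] by simp
      also have "\<dots> \<le> max_dist y (rational_point p' q')" using far y q' False by simp
      finally show ?thesis .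
    qed
    obtain Q' where Q': "target (Suc k) Q'" "4 * real Q' powr (- 1 / real n) \<le> g"
      "4 * A * R * real Q' powr (- \<alpha>) \<le> r'"
      "(4 * A * R * real Q' powr (- \<alpha>) / r') powr s' \<le> (eps (Suc k) / 4 * real Q' powr (- \<tau>)) powr s"
      using target_exists[OF r'0 g, of "Suc k"] .
    let ?w = "Node z' r' (Suc k) Q'"
    have "good_cube Q' z' r'"
      unfolding good_cube_def badly_approximable_to_def
      using gap Q'(2) by (meson min.coboundedI1 order_trans)
    \<comment> \<open>The radius is now below the scale of the goal, so the quotient in
      \<open>mass2'\<close> is at least 1 and the reserved bound is released; it passes to
      \<open>r'\<close> because
      \<open>real Q powr (- \<tau>) \<le> \<psi> Q \<le> \<psi> q\<close>.\<close>
    moreover have "1 / N ^ Suc m \<le> r' powr s"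
    proof -
      have "1 \<le> 4 * A * R * real Q powr (- \<alpha>) / r1" using False r1 by simp
      then have "1 \<le> (4 * A * R * real Q powr (- \<alpha>) / r1) powr s'" using s by (simp add: ge_one_powr_ge_zero)
      then have "1 / N ^ Suc m * 1 \<le> 1 / N ^ Suc m * (4 * A * R * real Q powr (- \<alpha>) / r1) powr s'"
        using N by (intro mult_left_mono) auto
      also have "\<dots> \<le> (eps k / 4 * real Q powr (- \<tau>)) powr s" by (rule mass2')
      also have "\<dots> \<le> r' powr s"
      proof (rule powr_mono2)
        have "real Q powr (- \<tau>) \<le> \<psi> q"
          using tgt psi_antimono[OF q(1,2)] by (auto simp: target_def)
        then show "eps k / 4 * real Q powr (- \<tau>) \<le> r'"
          unfolding r'_def using eps[of k] by (intro mult_left_mono) auto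
      qed (use s eps[of k] in auto)
      finally show ?thesis by simp
    qed
    moreover have "1 / N ^ Suc m * (4 * A * R * real Q' powr (- \<alpha>) / r') powr s'
        \<le> (eps (Suc k) / 4 * real Q' powr (- \<tau>)) powr s"
    proof -
      have "1 \<le> N" using G by (simp add: N_def)
      then have "1 / N ^ Suc m \<le> 1" using one_le_power[of N "Suc m"] by (simp add: divide_le_eq)
      then have "1 / N ^ Suc m * (4 * A * R * real Q' powr (- \<alpha>) / r') powr s'
          \<le> 1 * (4 * A * R * real Q' powr (- \<alpha>) / r') powr s'" by (intro mult_right_mono) auto
      with Q'(4) show ?thesis by linarith
    qed
    ultimately have "node_inv (Suc m) ?w"
      using r'0 Q' by (simp add: node_inv_def N_def)
    moreover have "refines v ?w"
      unfolding refines_def v node.sel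
    proof (intro conjI ballI allI impI disjI2)
      show "cube z' r' \<subseteq> cube z r" using sub' sub by blast
      show "r' \<le> r / R" using r' by (simp add: r1_def)
      fix y p' q' assume "y \<in> cube z' r'" "1 \<le> q'" "\<psi> q' \<le> \<kappa> * real q' powr (- \<alpha>)"
        "b < r * real q' powr \<alpha>" "r' * real q' powr \<alpha> \<le> b"
      then show "(1 - eps k) * \<psi> q' \<le> max_dist y (rational_point p' q')"
        using far[of y q' p'] avoid_of_branches[OF ch' d r, of y q' k p'] sub'
        by (cases "r1 * real q' powr \<alpha> \<le> b") (auto simp: r1_def)
    next
      have "real k + 1 \<le> real q" using tgt q(3) by (simp add: target_def)
      then have "k + 1 \<le> q" by linarith
      with close show "\<exists>p q. k + 1 \<le> q \<and> (\<forall>y\<in>cube z' r'. max_dist y (rational_point p q) < \<psi> q)"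
        by blast
    qed simp
    ultimately show thesis by (rule that) (use sub' in \<open>simp add: v r1_def\<close>)
  qed
qed

lemma children_exist:
  assumes inv: "node_inv m v"
  shows "\<exists>ch. (\<forall>d<G ^ n. node_inv (Suc m) (ch d) \<and> refines v (ch d)) \<and>
    (\<forall>d<G ^ n. \<forall>e<G ^ n. d \<noteq> e \<longrightarrow>
      (\<forall>y\<in>node_cube (ch d). \<forall>y'\<in>node_cube (ch e). 2 * (radius v / R) \<le> max_dist y y'))"
proof -
  have "0 < radius v" using inv by (simp add: node_inv_def)
  then obtain c where c: "branches (center v) (radius v) c" using branches_exist by blast
  have "\<forall>d. \<exists>w. d < G ^ n \<longrightarrow> node_inv (Suc m) w \<and> refines v w \<and> node_cube w \<subseteq> cube (c d) (radius v / R)"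
    using child_exists[OF inv c] by metis
  then obtain ch where ch: "\<And>d. d < G ^ n \<Longrightarrow> node_inv (Suc m) (ch d) \<and> refines v (ch d) \<and>
      node_cube (ch d) \<subseteq> cube (c d) (radius v / R)" by metis
  show ?thesis
  proof (intro exI[of _ ch] conjI allI impI ballI)
    fix d e y y' assume "d < G ^ n" "e < G ^ n" "d \<noteq> e" "y \<in> node_cube (ch d)" "y' \<in> node_cube (ch e)"
    then show "2 * (radius v / R) \<le> max_dist y y'"
      using ch c unfolding branches_def by (meson subsetD)
  qed (use ch in auto)
qed

section \<open>Limit points of the tree\<close>

context
  fixes v :: "nat \<Rightarrow> 'n node" and x :: "real ^ 'n"
  assumes inv: "\<And>m. node_inv m (v m)"
    and ref: "\<And>m. refines (v m) (v (Suc m))"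
    and x: "\<And>m. x \<in> node_cube (v m)"
begin

lemma radius_pos: "0 < radius (v m)"
  using inv by (simp add: node_inv_def)

lemma radius_le: "radius (v m) \<le> radius (v 0) / R ^ m"
proof (induction m)
  case (Suc m)
  have "radius (v (Suc m)) \<le> radius (v m) / R" using ref by (simp add: refines_def)
  also have "\<dots> \<le> (radius (v 0) / R ^ m) / R" using Suc R by (intro divide_right_mono) auto
  finally show ?case by (simp add: mult.commute)
qed simp

lemma radius_tends_to_0:
  assumes "0 < e"
  obtains m where "\<And>m'. m \<le> m' \<Longrightarrow> radius (v m') < e"
proof -
  obtain m where m: "radius (v 0) / e < R ^ m" using real_arch_pow[OF R(3)] by blast
  have "radius (v m') < e" if "m \<le> m'" for m'
  proof -
    have "R ^ m \<le> R ^ m'" using that R by (intro power_increasing) auto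
    then have "e * R ^ m \<le> e * R ^ m'" using assms by simp
    moreover have "radius (v 0) < e * R ^ m" using m assms by (simp add: field_simps)
    ultimately have "radius (v 0) < e * R ^ m'" by linarith
    then have "radius (v 0) / R ^ m' < e" using R by (simp add: field_simps)
    then show ?thesis using radius_le[of m'] by linarith
  qed
  then show thesis by (rule that)
qed

lemma height_reached:
  obtains m where "radius (v m) * real q powr \<alpha> \<le> b"
proof (cases "q = 0")
  case True
  then show thesis using b by (intro that[of 0]) simp
next
  case False
  then have "0 < b / real q powr \<alpha>" using b by simp
  then obtain m where "radius (v m) < b / real q powr \<alpha>"
    using radius_tends_to_0 by blast
  then show thesis using False by (intro that[of m]) (simp add: field_simps)
qed

lemma stage_Suc: "stage (v (Suc m)) = stage (v m) \<or> stage (v (Suc m)) = Suc (stage (v m))"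
  using ref[of m] unfolding refines_def by blast

lemma stage_mono: "m \<le> m' \<Longrightarrow> stage (v m) \<le> stage (v m')"
proof (rule lift_Suc_mono_le[of "\<lambda>m. stage (v m)"])
  show "stage (v i) \<le> stage (v (Suc i))" for i using stage_Suc[of i] by auto
qed

text \<open>While the stage is constant so is the goal, and \<open>node_inv\<close> keeps the radius
  above a fixed positive number; but the radii tend to 0.\<close>

lemma stage_unbounded: "\<exists>m. K \<le> stage (v m)"
proof (induction K)
  case (Suc K)
  then obtain m where m: "K \<le> stage (v m)" by blast
  show ?case
  proof (rule ccontr)
    assume neg: "\<not> ?thesis"
    have const: "stage (v m') = stage (v m) \<and> goal (v m') = goal (v m)" if "m \<le> m'" for m'
      using that
    proof (induction rule: dec_induct)
      case (step i)
      have "stage (v (Suc i)) \<noteq> Suc (stage (v i))"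
        using neg m step by (metis Suc_le_mono)
      then show ?case using ref[of i] step unfolding refines_def by metis
    qed simp
    have "1 \<le> goal (v m)" using inv[of m] by (simp add: node_inv_def target_def)
    then have "0 < 4 * A * R * real (goal (v m)) powr (- \<alpha>)" using A R by simp
    then obtain m1 where m1: "\<And>m'. m1 \<le> m' \<Longrightarrow> radius (v m') < 4 * A * R * real (goal (v m)) powr (- \<alpha>)"
      using radius_tends_to_0 by blast
    have "4 * A * R * real (goal (v m)) powr (- \<alpha>) \<le> radius (v (max m m1))"
      using inv[of "max m m1"] const[of "max m m1"] by (simp add: node_inv_def)
    with m1[of "max m m1"] show False by simp
  qed
qed simp

section \<open>Diophantine properties of a limit point\<close>

lemma psi_tends_to_0:
  assumes "0 < e"
  shows "\<forall>\<^sub>F q in sequentially. \<psi> q \<le> e"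
  using psi_small_alpha[OF assms] eventually_ge_at_top[of 1]
proof eventually_elim
  case (elim q)
  have "real q powr (- \<alpha>) \<le> real q powr 0" using elim(2) alpha by (intro powr_mono) auto
  then have "e * real q powr (- \<alpha>) \<le> e * 1" using assms elim(2) by (intro mult_left_mono) auto
  then show ?case using elim by linarith
qed

lemma limit_point_irrational:
  assumes q: "1 \<le> q"
  shows "0 < max_dist x (rational_point p q)"
proof -
  obtain m where m: "radius (v m) * real q powr \<alpha> \<le> b" by (rule height_reached)
  have "badly_approximable_to (goal (v m)) q x"
    using inv[of m] x[of m] q m unfolding node_inv_def good_cube_def by blast
  then have "min (4 * real (goal (v m)) powr (- 1 / real n)) (\<kappa> * real q powr (- \<alpha>))
      \<le> max_dist x (rational_point p q)" unfolding badly_approximable_to_def by blast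
  moreover have "1 \<le> goal (v m)" using inv[of m] by (simp add: node_inv_def target_def)
  then have "0 < min (4 * real (goal (v m)) powr (- 1 / real n)) (\<kappa> * real q powr (- \<alpha>))"
    using kappa q by simp
  ultimately show ?thesis by linarith
qed

lemma limit_point_hits:
  obtains p q where "K \<le> q" "1 \<le> q" "max_dist x (rational_point p q) < \<psi> q"
proof -
  define K' where "K' = max K (stage (v 0))"
  \<comment> \<open>The first time the stage passes \<open>K'\<close>. The stage grows by at most
    one, so it equals \<open>K'\<close> just before, and this step is an approximation with
    denominator at least \<open>K' + 1\<close>. The maximum with the initial stage excludes
    \<open>m = 0\<close>.\<close>
  define m where "m = (LEAST m. Suc K' \<le> stage (v m))"
  have m: "Suc K' \<le> stage (v m)" unfolding m_def using stage_unbounded by (rule LeastI_ex)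
  have "m \<noteq> 0"
  proof
    assume "m = 0"
    then show False using m by (simp add: K'_def)
  qed
  then obtain i where i: "m = Suc i" using not0_implies_Suc by blast
  have "\<not> Suc K' \<le> stage (v i)" unfolding m_def[symmetric] using not_less_Least[of i "\<lambda>m. Suc K' \<le> stage (v m)"] i
    by (simp add: m_def[symmetric])
  then have "stage (v i) = K'" "stage (v (Suc i)) \<noteq> stage (v i)" using stage_Suc[of i] m i by auto
  then obtain p q where "K' + 1 \<le> q" "\<forall>y\<in>node_cube (v (Suc i)). max_dist y (rational_point p q) < \<psi> q"
    using ref[of i] unfolding refines_def by auto
  then show thesis using x[of "Suc i"] by (intro that[of q p]) (auto simp: K'_def)
qed

text \<open>The hits might represent only finitely many rational points; then the distances to these
  would have a positive minimum, against \<open>\<psi>\<close> tending to 0.\<close>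

lemma limit_point_in_W: "x \<in> W \<psi>"
proof -
  let ?S = "{r. \<exists>p q. 1 \<le> q \<and> r = rational_point p q \<and> max_dist x r < \<psi> q}"
  have "infinite ?S"
  proof
    assume fin: "finite ?S"
    define \<delta> where "\<delta> = Min (insert 1 (max_dist x ` ?S))"
    have "0 < \<delta>" unfolding \<delta>_def using fin limit_point_irrational by (subst Min_gr_iff) auto
    then have "0 < \<delta> / 2" by simp
    from psi_tends_to_0[OF this] obtain K where K: "\<And>q. K \<le> q \<Longrightarrow> \<psi> q \<le> \<delta> / 2"
      by (auto simp: eventually_sequentially)
    obtain p q where pq: "K \<le> q" "1 \<le> q" "max_dist x (rational_point p q) < \<psi> q"
      by (rule limit_point_hits)
    then have "rational_point p q \<in> ?S" by blast
    then have "\<delta> \<le> max_dist x (rational_point p q)" unfolding \<delta>_def using fin by (intro Min_le) auto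
    then show False using K[OF pq(1)] pq(3) \<open>0 < \<delta>\<close> by linarith
  qed
  then show ?thesis by (simp add: W_def)
qed

text \<open>A large denominator becomes treated at some step after stage \<open>K\<close> is
  reached, and \<open>refines\<close> gives the bound at that step.\<close>

lemma limit_point_avoids:
  shows "\<exists>q0. \<forall>q\<ge>q0. \<forall>p. (1 - eps K) * \<psi> q \<le> max_dist x (rational_point p q)"
proof -
  obtain m0 where m0: "K \<le> stage (v m0)" using stage_unbounded by blast
  obtain q1 where q1: "\<And>q. q1 \<le> q \<Longrightarrow> \<psi> q \<le> \<kappa> * real q powr (- \<alpha>)"
    using psi_small_alpha[OF kappa] by (auto simp: eventually_sequentially)
  have "\<forall>\<^sub>F q in sequentially. real q powr (- \<alpha>) \<le> radius (v m0) / (2 * b)"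
    using radius_pos b alpha by (intro eventually_powr_le) auto
  then obtain q2 where q2: "\<And>q. q2 \<le> q \<Longrightarrow> real q powr (- \<alpha>) \<le> radius (v m0) / (2 * b)"
    by (auto simp: eventually_sequentially)
  have "(1 - eps K) * \<psi> q \<le> max_dist x (rational_point p q)" if q: "max 1 (max q1 q2) \<le> q" for p q
  proof -
    have q': "1 \<le> q" using q by simp
    have "real q powr (- \<alpha>) \<le> radius (v m0) / (2 * b)" using q2 q by simp
    then have "2 * b \<le> radius (v m0) * real q powr \<alpha>"
      using b q' by (simp add: powr_minus field_simps)
    then have b0: "b < radius (v m0) * real q powr \<alpha>" using b by linarith
    have *: "(1 - eps K) * \<psi> q \<le> max_dist x (rational_point p q)"
      if "m0 \<le> m" "radius (v m) * real q powr \<alpha> \<le> b" for m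
      using that
    proof (induction rule: dec_induct)
      \<comment> \<open>Vacuous, since \<open>q\<close> is too large to be treated at
        \<open>m0\<close>.\<close>
      case base
      then show ?case using b0 by simp
    next
      case (step m)
      show ?case
      proof (cases "radius (v m) * real q powr \<alpha> \<le> b")
        case False
        have "(1 - eps (stage (v m))) * \<psi> q \<le> max_dist x (rational_point p q)"
          using ref[of m] x[of "Suc m"] q q' q1 False step.prems unfolding refines_def by auto
        moreover have "K \<le> stage (v m)" using stage_mono[OF step.hyps(1)] m0 by simp
        then have "eps (stage (v m)) \<le> eps K" unfolding eps_def by (intro divide_left_mono) auto
        then have "(1 - eps K) * \<psi> q \<le> (1 - eps (stage (v m))) * \<psi> q"
          using psi_pos[OF q'] by (intro mult_right_mono) auto
        ultimately show ?thesis by linarith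
      qed (use step.IH in blast)
    qed
    obtain m where m: "radius (v m) * real q powr \<alpha> \<le> b" by (rule height_reached)
    have "m0 \<le> m"
    proof (rule ccontr)
      assume "\<not> m0 \<le> m"
      then have "m \<le> m0" by simp
      then have "radius (v m0) \<le> radius (v m)"
      proof (rule lift_Suc_antimono_le[of "\<lambda>m. radius (v m)", rotated])
        fix i
        have "radius (v (Suc i)) \<le> radius (v i) / R" using ref by (simp add: refines_def)
        also have "\<dots> \<le> radius (v i)" using R radius_pos[of i] by (simp add: field_simps)
        finally show "radius (v (Suc i)) \<le> radius (v i)" .
      qed
      then have "radius (v m0) * real q powr \<alpha> \<le> radius (v m) * real q powr \<alpha>"
        by (intro mult_right_mono) auto
      then show False using m b0 by linarith
    qed
    then show ?thesis using * m by blast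
  qed
  then show ?thesis by blast
qed

text \<open>For \<open>c < 1\<close> some \<open>eps K\<close> is below \<open>1 - c\<close>;
  approximations of quality \<open>c * \<psi> q\<close> then have bounded denominators, and only
  finitely many such points are near \<open>x\<close>.\<close>

lemma limit_point_in_E: "x \<in> E \<psi>"
proof -
  have "x \<notin> W (\<lambda>q. c * \<psi> q)" if c: "0 < c" "c < 1" for c
  proof -
    obtain K where K: "1 / (1 - c) < real K" using reals_Archimedean2 by blast
    have "eps K < 1 - c" using K c by (simp add: eps_def field_simps)
    obtain q0 where q0: "\<And>q p. q0 \<le> q \<Longrightarrow> (1 - eps K) * \<psi> q \<le> max_dist x (rational_point p q)"
      using limit_point_avoids by blast
    let ?F = "{(p, q). 1 \<le> q \<and> q \<le> q0 \<and> max_dist x (rational_point p q) \<le> \<psi> 1}"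
    have "{r. \<exists>p q. 1 \<le> q \<and> r = rational_point p q \<and> max_dist x r < c * \<psi> q}
        \<subseteq> (\<lambda>(p, q). rational_point p q) ` ?F"
    proof clarify
      fix p :: "int ^ 'n" and q :: nat
      assume q: "1 \<le> q" and d: "max_dist x (rational_point p q) < c * \<psi> q"
      have psi: "0 < \<psi> q" using psi_pos q by simp
      have "q \<le> q0"
      proof (rule ccontr)
        assume "\<not> q \<le> q0"
        then have "(1 - eps K) * \<psi> q \<le> max_dist x (rational_point p q)" by (intro q0) simp
        moreover have "c * \<psi> q < (1 - eps K) * \<psi> q" using psi \<open>eps K < 1 - c\<close> by simp
        ultimately show False using d by linarith
      qed
      moreover have "c * \<psi> q \<le> 1 * \<psi> 1" using c psi psi_antimono[of 1 q] q by (intro mult_mono) auto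
      ultimately have "(p, q) \<in> ?F" using q d by simp
      then show "rational_point p q \<in> (\<lambda>(p, q). rational_point p q) ` ?F" by force
    qed
    then have "finite {r. \<exists>p q. 1 \<le> q \<and> r = rational_point p q \<and> max_dist x r < c * \<psi> q}"
      by (rule finite_subset) (intro finite_imageI finite_near_rationals)
    then show ?thesis by (simp add: W_def)
  qed
  then show ?thesis using limit_point_in_W by (auto simp: E_def)
qed

end

section \<open>The limit set and its Hausdorff measure\<close>

lemma limit_point_exists:
  assumes "\<And>m. node_inv m (v m)" "\<And>m. refines (v m) (v (Suc m))"
  shows "\<exists>x. \<forall>m. x \<in> node_cube (v m)"
proof -
  have "\<Inter> (range (\<lambda>m. node_cube (v m))) \<noteq> {}"
  proof (rule compact_nest)
    show "compact (node_cube (v m))" for m by (rule compact_cube)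
    have "center (v m) \<in> node_cube (v m)" for m
      using assms(1)[of m] by (intro center_in_cube) (simp add: node_inv_def)
    then show "node_cube (v m) \<noteq> {}" for m by blast
    show "node_cube (v m') \<subseteq> node_cube (v m)" if "m \<le> m'" for m m'
      by (rule lift_Suc_antimono_le[of "\<lambda>m. node_cube (v m)", OF _ that])
        (use assms(2) in \<open>simp add: refines_def\<close>)
  qed
  then show ?thesis by blast
qed

text \<open>Two numbers with first differing digit \<open>m\<close> are at most
  \<open>1 / real N ^ m\<close> apart. Their limit points are separated by a multiple of the radius
  at level \<open>m\<close>, whose \<open>s\<close>-th power is at least
  \<open>1 / real N ^ m\<close> by \<open>node_inv\<close>. This is the Hoelder bound.\<close>

lemma hausdorff_measure_E_neq_0:
  assumes t: "0 \<le> t" "t \<le> s"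
  shows "hausdorff_measure max_dist t (E \<psi> :: (real ^ 'n) set) \<noteq> 0"
proof -
  define N where "N = G ^ n"
  have N: "2 \<le> N" using G n_pos self_le_power[of G n] by (simp add: N_def)
  obtain v0 where v0: "node_inv 0 v0" by (rule root_exists)
  obtain ch where ch: "\<And>m v d. node_inv m v \<Longrightarrow> d < N \<Longrightarrow> node_inv (Suc m) (ch m v d) \<and> refines v (ch m v d)"
    and sep: "\<And>m v d e y y'. node_inv m v \<Longrightarrow> d < N \<Longrightarrow> e < N \<Longrightarrow> d \<noteq> e \<Longrightarrow> y \<in> node_cube (ch m v d)
      \<Longrightarrow> y' \<in> node_cube (ch m v e) \<Longrightarrow> 2 * (radius v / R) \<le> max_dist y y'"
  proof -
    have "\<forall>m v. \<exists>c. node_inv m v \<longrightarrow> (\<forall>d<G ^ n. node_inv (Suc m) (c d) \<and> refines v (c d)) \<and>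
      (\<forall>d<G ^ n. \<forall>e<G ^ n. d \<noteq> e \<longrightarrow>
        (\<forall>y\<in>node_cube (c d). \<forall>y'\<in>node_cube (c e). 2 * (radius v / R) \<le> max_dist y y'))"
      using children_exist by blast
    then obtain c where c: "\<forall>m v. node_inv m v \<longrightarrow> (\<forall>d<G ^ n. node_inv (Suc m) (c m v d) \<and> refines v (c m v d)) \<and>
      (\<forall>d<G ^ n. \<forall>e<G ^ n. d \<noteq> e \<longrightarrow>
        (\<forall>y\<in>node_cube (c m v d). \<forall>y'\<in>node_cube (c m v e). 2 * (radius v / R) \<le> max_dist y y'))"
      by metis
    show thesis
      by (rule that[of c]) (use c in \<open>auto simp: N_def\<close>)
  qed
  \<comment> \<open>Digits are counted from 0, so agreement of all digits below \<open>m\<close>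
    means equal \<open>trunc\<close> at \<open>m\<close>, that is, the same interval of length
    \<open>1 / real N ^ m\<close>.\<close>
  define trunc where "trunc = (\<lambda>(u :: real) m. nat \<lfloor>u * real N ^ m\<rfloor>)"
  define digit where "digit = (\<lambda>u m. trunc u (Suc m) mod N)"
  define path where "path = (\<lambda>u. rec_nat v0 (\<lambda>m v. ch m v (digit u m)))"
  have path_0: "path u 0 = v0" and path_Suc: "path u (Suc m) = ch m (path u m) (digit u m)" for u m
    by (simp_all add: path_def)
  have digit: "digit u m < N" for u m using N by (simp add: digit_def)
  have inv: "node_inv m (path u m)" for u m
    by (induction m) (use v0 ch digit in \<open>auto simp: path_0 path_Suc\<close>)
  have ref: "refines (path u m) (path u (Suc m))" for u m
    using ch[OF inv digit] by (simp add: path_Suc)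
  obtain g where g: "\<And>u m. g u \<in> node_cube (path u m)"
    using limit_point_exists[of "path u" for u, OF inv ref] by metis
  have trunc_Suc: "trunc u (Suc m) = N * trunc u m + digit u m" if "0 \<le> u" for u m
  proof -
    have "\<lfloor>u * real N ^ m\<rfloor> = \<lfloor>u * real N ^ Suc m / real_of_int (int N)\<rfloor>" using N by simp
    also have "\<dots> = \<lfloor>u * real N ^ Suc m\<rfloor> div int N"
      by (rule floor_divide_real_eq_div) simp
    finally have "trunc u m = trunc u (Suc m) div N"
      using that by (simp add: trunc_def nat_div_distrib)
    then show ?thesis by (simp add: digit_def)
  qed
  have same_path: "path u m = path u' m" if "\<And>i. i < m \<Longrightarrow> digit u i = digit u' i" for u u' m
    using that by (induction m) (simp_all add: path_0 path_Suc)
  have close: "\<bar>u - u'\<bar> \<le> 1 / real N ^ m"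
    if u: "u \<in> {0..<1}" "u' \<in> {0..<1}" and eq: "\<And>i. i < m \<Longrightarrow> digit u i = digit u' i" for u u' m
  proof -
    have "trunc u m = trunc u' m" using eq
    proof (induction m)
      case 0
      have "\<lfloor>u\<rfloor> = 0" "\<lfloor>u'\<rfloor> = 0" using u by (auto simp: floor_eq_iff)
      then show ?case by (simp add: trunc_def)
    next
      case (Suc m)
      then show ?case using u by (simp add: trunc_Suc)
    qed
    moreover have "0 \<le> \<lfloor>u * real N ^ m\<rfloor>" "0 \<le> \<lfloor>u' * real N ^ m\<rfloor>" using u by auto
    ultimately have "\<lfloor>u * real N ^ m\<rfloor> = \<lfloor>u' * real N ^ m\<rfloor>" unfolding trunc_def by linarith
    then have "\<bar>u * real N ^ m - u' * real N ^ m\<bar> \<le> 1" by linarith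
    moreover have "\<bar>u * real N ^ m - u' * real N ^ m\<bar> = \<bar>u - u'\<bar> * real N ^ m"
      by (simp add: left_diff_distrib[symmetric] abs_mult)
    ultimately show ?thesis using N by (simp add: field_simps)
  qed
  have holder: "\<bar>u - u'\<bar> \<le> (R / 2) powr s * max_dist (g u) (g u') powr s"
    if u: "u \<in> {0..<1}" "u' \<in> {0..<1}" for u u'
  proof (cases "\<exists>m. digit u m \<noteq> digit u' m")
    case False
    have "\<bar>u - u'\<bar> \<le> 0"
    proof (rule ccontr)
      assume "\<not> ?thesis"
      moreover obtain m where "1 / \<bar>u - u'\<bar> < real N ^ m" using real_arch_pow[of "real N"] N by auto
      ultimately have "1 / real N ^ m < \<bar>u - u'\<bar>" using N by (simp add: field_simps)
      then show False using close[OF u, of m] False by auto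
    qed
    then show ?thesis by simp
  next
    case True
    define m where "m = (LEAST m. digit u m \<noteq> digit u' m)"
    have neq: "digit u m \<noteq> digit u' m" unfolding m_def using True by (rule LeastI_ex)
    have eq: "digit u i = digit u' i" if "i < m" for i
      using not_less_Least[of i "\<lambda>m. digit u m \<noteq> digit u' m"] that by (auto simp: m_def)
    let ?v = "path u m"
    have v': "path u' m = ?v" using same_path eq by metis
    have "2 * (radius ?v / R) \<le> max_dist (g u) (g u')"
      using sep[OF inv[of m u] digit digit neq] g[of u "Suc m"] g[of u' "Suc m"]
      by (simp add: path_Suc v')
    then have "radius ?v \<le> R / 2 * max_dist (g u) (g u')" using R by (simp add: field_simps)
    moreover have "0 < radius ?v" "1 / real N ^ m \<le> radius ?v powr s"
      using inv[of m u] by (auto simp: node_inv_def N_def)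
    ultimately have "1 / real N ^ m \<le> (R / 2 * max_dist (g u) (g u')) powr s"
      using s powr_mono2[of s "radius ?v" "R / 2 * max_dist (g u) (g u')"] by linarith
    moreover have "\<bar>u - u'\<bar> \<le> 1 / real N ^ m" using eq by (intro close[OF u])
    ultimately show ?thesis unfolding powr_mult by linarith
  qed
  show ?thesis
  proof (rule hausdorff_measure_neq_0_of_inverse_Holder[where g = g and C = "(R / 2) powr s" and r = s])
    show "g u \<in> E \<psi>" for u using limit_point_in_E[of "path u", OF inv ref g] .
  qed (use holder in blast, use R s t in auto)
qed

end

section \<open>The dimension formula\<close>

text \<open>Covers by the balls of radius \<open>\<psi> q\<close> around p/q. A bounded part of
  space meets at most a constant times \<open>q ^ n\<close> of them, and the sum of
  \<open>real q powr (real n - \<tau> * s)\<close> converges as \<open>s > s1\<close>. The bounded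
  parts form a countable union.\<close>

lemma hausdorff_measure_W_eq_0:
  fixes \<psi> :: "nat \<Rightarrow> real"
  assumes pos: "\<And>q. 1 \<le> q \<Longrightarrow> 0 < \<psi> q"
    and mono: "\<And>q q'. 1 \<le> q \<Longrightarrow> q \<le> q' \<Longrightarrow> \<psi> q' \<le> \<psi> q"
    and s: "0 < s1" "s1 < s"
    and small: "\<forall>\<^sub>F q in sequentially. \<psi> q \<le> real q powr (- ((real CARD('n::finite) + 1) / s1))"
  shows "hausdorff_measure max_dist s (W \<psi> :: (real ^ 'n) set) = 0"
proof -
  define n where "n = CARD('n)"
  define \<tau> where "\<tau> = (real n + 1) / s1"
  have \<tau>: "0 < \<tau>" "real n - \<tau> * s < - 1"
  proof -
    show "0 < \<tau>" using s by (simp add: \<tau>_def)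
    then have "\<tau> * s1 < \<tau> * s" using s by simp
    moreover have "\<tau> * s1 = real n + 1" using s by (simp add: \<tau>_def)
    ultimately show "real n - \<tau> * s < - 1" by simp
  qed
  have small': "\<forall>\<^sub>F q in sequentially. \<psi> q \<le> real q powr (- \<tau>)"
    using small by (simp add: \<tau>_def n_def)
  have null: "hausdorff_measure max_dist s {x \<in> W \<psi> :: (real ^ 'n) set. infnorm x \<le> real j} = 0" for j :: nat
  proof (rule hausdorff_measure_eq_0I)
    fix \<delta> :: real assume \<delta>: "0 < \<delta>"
    let ?W = "{x \<in> W \<psi> :: (real ^ 'n) set. infnorm x \<le> real j}"
    \<comment> \<open>The first factor counts numerators, at most
      \<open>(q * (2 * j + 3)) ^ n\<close> for denominator \<open>q\<close>; the second comes from
      the diameter bound \<open>2 * \<psi> q\<close>.\<close>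
    define c where "c = real (2 * j + 3) ^ n * 2 powr s"
    define a where "a = (\<lambda>q. c * real q powr (real n - \<tau> * s))"
    have c: "0 < c" by (simp add: c_def)
    have "summable a" unfolding a_def using \<tau>(2) by (intro summable_mult) (simp add: summable_real_powr_iff)
    show "hausdorff_premeasure max_dist s \<delta> ?W = 0"
    proof (rule antisym)
      show "hausdorff_premeasure max_dist s \<delta> ?W \<le> 0"
      proof (rule ennreal_le_epsilon)
        fix e :: real assume e: "0 < e"
        obtain q2 where q2: "\<And>m. q2 \<le> m \<Longrightarrow> norm (\<Sum>i. a (i + m)) < e"
          using suminf_exist_split[OF e \<open>summable a\<close>] by blast
        have "\<forall>\<^sub>F q in sequentially. real q powr (- \<tau>) \<le> min 1 (\<delta> / 2)"
          using \<tau> \<delta> by (intro eventually_powr_le) auto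
        then have "\<forall>\<^sub>F q in sequentially. \<psi> q \<le> real q powr (- \<tau>) \<and> \<psi> q \<le> 1 \<and> \<psi> q \<le> \<delta> / 2"
          using small' by eventually_elim auto
        then obtain q3 where q3: "\<And>q. q3 \<le> q \<Longrightarrow> \<psi> q \<le> real q powr (- \<tau>) \<and> \<psi> q \<le> 1 \<and> \<psi> q \<le> \<delta> / 2"
          by (auto simp: eventually_sequentially)
        define q1 where "q1 = max 1 (max q2 q3)"
        have q1: "1 \<le> q1" "q2 \<le> q1" "q3 \<le> q1" by (auto simp: q1_def)
        define B where "B = (\<lambda>q. {p :: int ^ 'n. \<forall>i. \<bar>p $ i\<bar> \<le> int (q * (j + 1))})"
        have finB: "finite (B q)" for q unfolding B_def by (rule finite_int_box)
        have cardB: "card (B q) \<le> (q * (2 * j + 3)) ^ n" if "1 \<le> q" for q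
        proof -
          have "card (B q) \<le> nat (2 * int (q * (j + 1)) + 1) ^ n"
            unfolding B_def n_def by (rule finite_int_box) simp
          also have "\<dots> \<le> (q * (2 * j + 3)) ^ n"
            using that by (intro power_mono) (auto simp: nat_le_iff algebra_simps)
          finally show ?thesis .
        qed
        have "\<exists>f. bij_betw f {..<card (B q)} (B q)" for q
          using ex_bij_betw_nat_finite[OF finB] by (simp add: atLeast0LessThan)
        then obtain f where f: "\<And>q. bij_betw (f q) {..<card (B q)} (B q)" by metis
        define U where "U = (\<lambda>i m. let q = i + q1 in
          if m < card (B q) then {x :: real ^ 'n. max_dist x (rational_point (f q m) q) < \<psi> q} else {})"
        have diam: "max_dist x y \<le> 2 * \<psi> (i + q1)" if "x \<in> U i m" "y \<in> U i m" for x y i m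
        proof -
          let ?r = "rational_point (f (i + q1) m) (i + q1)"
          have "max_dist x ?r < \<psi> (i + q1)" "max_dist y ?r < \<psi> (i + q1)"
            using that by (auto simp: U_def Let_def split: if_splits)
          then show ?thesis using max_dist_triangle[of x y ?r] by (simp add: max_dist_sym[of ?r])
        qed
        have cover: "?W \<subseteq> (\<Union>i. \<Union>m. U i m)"
        proof
          fix x assume "x \<in> ?W"
          then have xW: "infinite {r. \<exists>p q. 1 \<le> q \<and> r = rational_point p q \<and> max_dist x r < \<psi> q}"
            and xj: "infnorm x \<le> real j" by (auto simp: W_def)
          \<comment> \<open>The finitely many approximants with denominator at most
            \<open>q1\<close> cannot be all of them, so some approximant has a larger
            denominator.\<close>
          let ?F = "(\<lambda>(p, q). rational_point p q) `
            {(p :: int ^ 'n, q). 1 \<le> q \<and> q \<le> q1 \<and> max_dist x (rational_point p q) \<le> \<psi> 1}"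
          have "finite ?F" by (intro finite_imageI finite_near_rationals)
          with xW have "\<not> {r. \<exists>p q. 1 \<le> q \<and> r = rational_point p q \<and> max_dist x r < \<psi> q} \<subseteq> ?F"
            using finite_subset by blast
          then obtain p q where q: "1 \<le> q" and pq: "max_dist x (rational_point p q) < \<psi> q"
            and nF: "rational_point p q \<notin> ?F" by blast
          have "\<not> q \<le> q1"
          proof
            assume "q \<le> q1"
            moreover have "max_dist x (rational_point p q) \<le> \<psi> 1" using pq mono[of 1 q] q by linarith
            ultimately have "rational_point p q \<in> ?F" using q by force
            then show False using nF by simp
          qed
          then have qq: "q1 \<le> q" by simp
          have "p \<in> B q"
          proof -
            have "\<bar>p $ i\<bar> \<le> int (q * (j + 1))" for i
            proof -
              have "\<bar>x $ i - real_of_int (p $ i) / real q\<bar> < \<psi> q"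
                using pq abs_component_le_max_dist[of x i "rational_point p q"]
                by (simp add: rational_point_def)
              moreover have "\<psi> q \<le> 1" using q3 qq q1 by simp
              moreover have "\<bar>x $ i\<bar> \<le> infnorm x" by (rule component_le_infnorm_cart)
              ultimately have "\<bar>real_of_int (p $ i) / real q\<bar> \<le> real j + 1" using xj by linarith
              then have "\<bar>real_of_int (p $ i)\<bar> \<le> real q * (real j + 1)"
                using q by (simp add: abs_divide field_simps)
              then have "real_of_int \<bar>p $ i\<bar> \<le> real_of_int (int (q * (j + 1)))" by (simp add: algebra_simps)
              then show ?thesis by (simp only: of_int_le_iff)
            qed
            then show ?thesis by (simp add: B_def)
          qed
          then have "p \<in> f q ` {..<card (B q)}" using f[of q] by (simp add: bij_betw_def)
          then obtain m where "m < card (B q)" "f q m = p" by auto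
          then have "x \<in> U (q - q1) m" using pq qq by (simp add: U_def Let_def)
          then show "x \<in> (\<Union>i. \<Union>m. U i m)" by blast
        qed
        have "hausdorff_premeasure max_dist s \<delta> ?W \<le> (\<Sum>i. \<Sum>m. diam_pow max_dist s (U i m))"
        proof (rule hausdorff_premeasure_le_double_cover[OF cover])
          fix i m
          have "\<psi> (i + q1) \<le> \<delta> / 2" using q3[of "i + q1"] q1 by simp
          then have "max_dist x y \<le> \<delta>" if "x \<in> U i m" "y \<in> U i m" for x y
            using diam[OF that] by linarith
          then show "ediam max_dist (U i m) \<le> ennreal \<delta>" by (rule ediam_le)
        qed
        also have "\<dots> \<le> (\<Sum>i. ennreal (a (i + q1)))"
        proof (rule suminf_le)
          fix i
          let ?q = "i + q1"
          have q: "1 \<le> ?q" using q1 by simp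
          have \<psi>: "0 < \<psi> ?q" "\<psi> ?q \<le> real ?q powr (- \<tau>)" using pos[OF q] q3[of ?q] q1 by auto
          have "(\<Sum>m. diam_pow max_dist s (U i m)) = (\<Sum>m<card (B ?q). diam_pow max_dist s (U i m))"
            by (rule suminf_finite) (auto simp: U_def)
          also have "\<dots> \<le> (\<Sum>m<card (B ?q). ennreal ((2 * \<psi> ?q) powr s))"
            using diam \<psi> s by (intro sum_mono diam_pow_le) auto
          also have "\<dots> = ennreal (real (card (B ?q)) * (2 * \<psi> ?q) powr s)"
            by (simp add: ennreal_mult ennreal_of_nat_eq_real_of_nat)
          also have "\<dots> \<le> ennreal (a ?q)"
          proof (rule ennreal_leI)
            have "real (card (B ?q)) * (2 * \<psi> ?q) powr s
                \<le> real ((?q * (2 * j + 3)) ^ n) * (2 * real ?q powr (- \<tau>)) powr s"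
              using cardB[OF q] \<psi> s by (intro mult_mono of_nat_mono powr_mono2) auto
            also have "\<dots> = c * (real ?q powr real n * real ?q powr (- \<tau> * s))"
              using q by (simp add: c_def powr_mult powr_powr powr_realpow power_mult_distrib)
            also have "\<dots> = a ?q" by (simp add: a_def powr_add[symmetric])
            finally show "real (card (B ?q)) * (2 * \<psi> ?q) powr s \<le> a ?q" .
          qed
          finally show "(\<Sum>m. diam_pow max_dist s (U i m)) \<le> ennreal (a ?q)" .
        qed auto
        also have "\<dots> = ennreal (\<Sum>i. a (i + q1))"
          using summable_ignore_initial_segment[OF \<open>summable a\<close>, of q1] c
          by (intro suminf_ennreal2) (auto simp: a_def)
        also have "\<dots> \<le> ennreal e"
          using q2[OF q1(2)] by (intro ennreal_leI) simp
        finally show "hausdorff_premeasure max_dist s \<delta> ?W \<le> 0 + ennreal e" by simp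
      qed
    qed simp
  qed
  have "W \<psi> \<subseteq> (\<Union>j. {x \<in> W \<psi> :: (real ^ 'n) set. infnorm x \<le> real j})"
    using real_arch_simple by blast
  then have "hausdorff_measure max_dist s (W \<psi> :: (real ^ 'n) set)
      \<le> hausdorff_measure max_dist s (\<Union>j. {x \<in> W \<psi> :: (real ^ 'n) set. infnorm x \<le> real j})"
    by (rule hausdorff_measure_mono)
  also have "\<dots> = 0" using null by (rule hausdorff_measure_Union_null)
  finally show ?thesis by simp
qed

text \<open>By contraposition: if \<open>W \<psi>\<close> is not null, \<open>\<psi>\<close> is
  large infinitely often, and the tree gives \<open>E \<psi>\<close> positive measure. The gap
  \<open>t < s2\<close> provides the room for its parameters.\<close>

lemma hausdorff_measure_W_eq_0_of_E:
  fixes \<psi> :: "nat \<Rightarrow> real"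
  assumes pos: "\<And>q. 1 \<le> q \<Longrightarrow> 0 < \<psi> q"
    and mono: "\<And>q q'. 1 \<le> q \<Longrightarrow> q \<le> q' \<Longrightarrow> \<psi> q' \<le> \<psi> q"
    and small: "\<psi> \<in> o(\<lambda>q. real q powr (- ((real CARD('n::finite) + 1) / real CARD('n))))"
    and t: "0 \<le> t" "t < s2"
    and null: "hausdorff_measure max_dist t (E \<psi> :: (real ^ 'n) set) = 0"
  shows "hausdorff_measure max_dist s2 (W \<psi> :: (real ^ 'n) set) = 0"
proof (rule ccontr)
  assume W: "hausdorff_measure max_dist s2 (W \<psi> :: (real ^ 'n) set) \<noteq> 0"
  define n where "n = CARD('n)"
  have n: "0 < n" by (simp add: n_def)
  define \<alpha> where "\<alpha> = (real n + 1) / real n"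
  \<comment> \<open>\<open>s\<close> and \<open>s1\<close> trisect the interval from
    \<open>t\<close> to \<open>s2\<close>.\<close>
  define s where "s = (2 * t + s2) / 3"
  define s1 where "s1 = (t + 2 * s2) / 3"
  have s: "0 < s" "t \<le> s" "s < s1" "s1 < s2" using t by (auto simp: s_def s1_def)
  define \<tau> where "\<tau> = (real n + 1) / s1"
  have small': "\<forall>\<^sub>F q in sequentially. \<psi> q \<le> \<nu> * real q powr (- \<alpha>)" if "0 < \<nu>" for \<nu>
  proof -
    have "\<forall>\<^sub>F q in sequentially. norm (\<psi> q) \<le> \<nu> * norm (real q powr (- \<alpha>))"
      using landau_o.smallD[OF small that] by (simp add: \<alpha>_def n_def)
    then show ?thesis by eventually_elim simp
  qed
  have large: "\<exists>\<^sub>F Q in sequentially. real Q powr (- \<tau>) < \<psi> Q"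
    using W hausdorff_measure_W_eq_0[where \<psi> = \<psi> and ?s1.0 = s1 and s = s2, OF pos mono] s
    by (auto simp: \<tau>_def n_def frequently_def not_less)
  \<comment> \<open>At some \<open>Q > 1\<close> both
    \<open>real Q powr (- \<tau>) < \<psi> Q\<close> and
    \<open>\<psi> Q \<le> real Q powr (- \<alpha>)\<close> hold, which forces
    \<open>\<alpha> < \<tau>\<close>.\<close>
  have "s1 < real n"
  proof -
    have "\<forall>\<^sub>F Q in sequentially. real Q powr (- \<tau>) < \<psi> Q \<longrightarrow>
        real Q powr (- \<tau>) < real Q powr (- \<alpha>) \<and> 1 < Q"
      using small'[OF zero_less_one] eventually_gt_at_top[of 1]
    proof eventually_elim
      case (elim Q)
      then show ?case by (metis le_less_trans less_le_trans mult_1)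
    qed
    then have "\<exists>\<^sub>F Q in sequentially. real Q powr (- \<tau>) < real Q powr (- \<alpha>) \<and> 1 < Q"
      using large by (rule frequently_mp)
    then obtain Q where "real Q powr (- \<tau>) < real Q powr (- \<alpha>)" "1 < Q"
      by (blast dest: frequently_ex)
    then have "\<alpha> < \<tau>" by simp
    show ?thesis
    proof (rule ccontr)
      assume "\<not> ?thesis"
      then have "\<tau> \<le> \<alpha>" unfolding \<tau>_def \<alpha>_def using n by (intro divide_left_mono) auto
      then show False using \<open>\<alpha> < \<tau>\<close> by simp
    qed
  qed
  have ratio: "real n * s / s1 < real n" using s n by (simp add: field_simps)
  \<comment> \<open>The lower bound on \<open>s'\<close> yields
    \<open>\<tau> * s < \<alpha> * s'\<close>; the upper bound makes
    \<open>(4 * real G) powr s' \<le> real G ^ n\<close> true for large \<open>G\<close>.\<close>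
  obtain s' where s': "real n * s / s1 < s'" "s' < real n" using dense[OF ratio] by blast
  have "s * s1 \<le> s * real n" using s \<open>s1 < real n\<close> by (intro mult_left_mono) auto
  then have "s \<le> real n * s / s1" using s by (simp add: field_simps)
  then have ss': "s \<le> s'" using s' by linarith
  have exps: "\<tau> * s < \<alpha> * s'"
  proof -
    have "\<tau> * s = \<alpha> * (real n * s / s1)" using n by (simp add: \<tau>_def \<alpha>_def)
    also have "\<dots> < \<alpha> * s'" using s' n by (intro mult_strict_left_mono) (auto simp: \<alpha>_def)
    finally show ?thesis .
  qed
  have "\<forall>\<^sub>F G in sequentially. real G powr (s' - real n) \<le> 4 powr (- s')"
    using s' by (intro eventually_powr_le) auto
  then obtain G :: nat where G: "2 \<le> G" "real G powr (s' - real n) \<le> 4 powr (- s')"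
    using eventually_ge_at_top[of 2] eventually_conj eventually_happens' sequentially_bot by blast
  have branching: "(4 * real G) powr s' \<le> real G ^ n"
  proof -
    have "(4 * real G) powr s' = 4 powr s' * real G powr (s' - real n) * real G powr real n"
      by (simp add: powr_mult powr_add[symmetric])
    also have "\<dots> \<le> 4 powr s' * 4 powr (- s') * real G powr real n"
      using G by (intro mult_right_mono mult_left_mono) auto
    also have "\<dots> = real G ^ n" using G by (simp add: powr_add[symmetric] powr_realpow)
    finally show ?thesis .
  qed
  note t_le_s = s(2)
  interpret approximation_tree "0 :: real ^ 'n" n \<psi> G s s' \<tau>
  proof
    show "\<exists>\<^sub>F Q in sequentially. real Q powr (- \<tau>) \<le> \<psi> Q"
      using large by (rule frequently_elim1) simp
  qed (use pos mono small' G s ss' branching exps in \<open>auto simp: n_def \<alpha>_def\<close>)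
  show False using hausdorff_measure_E_neq_0[OF t(1) t_le_s] null by simp
qed

theorem theorem3:
  fixes \<psi> :: "nat \<Rightarrow> real"
  assumes "\<And>q. 1 \<le> q \<Longrightarrow> 0 < \<psi> q"
    and "antimono_on {1..} \<psi>"
    and "\<psi> \<in> o(\<lambda>s. real s powr (- ((real CARD('n::finite) + 1) / real CARD('n))))"
  shows "hausdorff_dim max_dist (E \<psi> :: (real ^ 'n) set)
       = hausdorff_dim max_dist (W \<psi> :: (real ^ 'n) set)"
proof (rule antisym)
  show "hausdorff_dim max_dist (E \<psi> :: (real ^ 'n) set) \<le> hausdorff_dim max_dist (W \<psi> :: (real ^ 'n) set)"
    by (rule hausdorff_dim_mono) (auto simp: E_def)
  have mono: "\<psi> q' \<le> \<psi> q" if "1 \<le> q" "q \<le> q'" for q q'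
    using monotone_onD[OF assms(2), of q q'] that by simp
  show "hausdorff_dim max_dist (W \<psi> :: (real ^ 'n) set) \<le> hausdorff_dim max_dist (E \<psi> :: (real ^ 'n) set)"
    unfolding hausdorff_dim_def[of max_dist "E \<psi>"]
  proof (rule INF_greatest)
    fix t assume "t \<in> {s. 0 \<le> s \<and> hausdorff_measure max_dist s (E \<psi> :: (real ^ 'n) set) = 0}"
    then have t: "0 \<le> t" "hausdorff_measure max_dist t (E \<psi> :: (real ^ 'n) set) = 0" by auto
    show "hausdorff_dim max_dist (W \<psi> :: (real ^ 'n) set) \<le> ennreal t"
    \<comment> \<open>The null sets are compared only at exponents \<open>t < t + e\<close>; letting
      \<open>e\<close> tend to 0 removes the loss.\<close>
    proof (rule ennreal_le_epsilon)
      fix e :: real assume e: "0 < e"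
      have "hausdorff_measure max_dist (t + e) (W \<psi> :: (real ^ 'n) set) = 0"
        using e by (intro hausdorff_measure_W_eq_0_of_E[OF assms(1) mono assms(3) t(1) _ t(2)]) auto
      then have "hausdorff_dim max_dist (W \<psi> :: (real ^ 'n) set) \<le> ennreal (t + e)"
        unfolding hausdorff_dim_def using t e by (intro INF_lower) auto
      then show "hausdorff_dim max_dist (W \<psi> :: (real ^ 'n) set) \<le> ennreal t + ennreal e"
        using t e by (simp add: ennreal_plus)
    qed
  qed
qed

end
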